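(* $\mathrm{Rel}(\textsc{Independent Set}, \mathrm{dist}_\Delta, n^{\frac12})$ is in FP.
   Context: For a problem $\Pi$, a metric $\mathrm{dist}$ on its inputs, and a non-decreasing function $d:\mathbb N\to\mathbb R_+\cup\{\infty\}$, the function problem $\mathrm{Rel}(\Pi,\mathrm{dist},d)$ is: given an input $I$ of $\Pi$, output a pair $(J,\Pi(J))$ where $J$ is an input of $\Pi$ with $\mathrm{dist}(I,J)\le d(|I|)$ and $\Pi(J)$ is a correct answer to $\Pi$ on $J$ (a correct solution on $J$, or $\mathrm{nil}$ if none exists). For graph problems $|I|$ is the number of vertices $n$ of the input graph. For graphs $G,H$: $\mathrm{dist}_\Delta(G,H)$ is the maximum degree of the graph on $V(G)$ with edge set $E(G)\triangle E(H)$ if $V(G)=V(H)$, and $\infty$ otherwise; $\mathrm{dist}_\Delta((G,k),(H,\ell))=\mathrm{dist}_\Delta(G,H)$ if $k=\ell$ and $\infty$ otherwise. \textsc{Independent Set}: given a graph $G$ and a non-negative integer $k$, output an independent set of $G$ of size $k$, or $\mathrm{nil}$ if none exists. FP is the class of function problems solvable in polynomial time. *)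

theory Defs
  imports Complex_Main "HOL-Library.Extended_Nonnegative_Real"
    "HOL-Computational_Algebra.Polynomial"
begin

section \<open>Function problems and their relaxations\<close>

text \<open>The answer set of a function problem may include an explicit ``nil'' answer (here \<open>None\<close>),
  so that every input has a correct answer; see \<open>search_answers\<close>.\<close>

record ('i, 'o) function_problem =
  inputs :: "'i set"
  answers :: "'i \<Rightarrow> 'o set"

definition search_answers :: "'s set \<Rightarrow> 's option set" where
  "search_answers S = (if S = {} then {None} else Some ` S)"

definition Rel :: "('i, 'o) function_problem \<Rightarrow> ('i \<Rightarrow> nat) \<Rightarrow> ('i \<Rightarrow> 'i \<Rightarrow> ennreal) \<Rightarrow>
    (nat \<Rightarrow> ennreal) \<Rightarrow> ('i, 'i \<times> 'o) function_problem" where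
  "Rel P sz dst d =
     \<lparr>inputs = inputs P,
      answers = (\<lambda>I. {(J, a). J \<in> inputs P \<and> dst I J \<le> d (sz I) \<and> a \<in> answers P J})\<rparr>"


section \<open>Deterministic multi-tape Turing machines\<close>

text \<open>States and tape symbols are natural numbers. Tapes are infinite in both directions. Symbol 0
  is the blank, symbols 1 and 2 represent the bits 0 and 1; a machine may use finitely many further
  symbols. Tape 0 is the input tape and tape 1 the output tape; all tapes may be read and
  written.\<close>

datatype move = MoveLeft | Stay | MoveRight

record turing_machine =
  num_tapes :: nat
  states :: "nat set"
  symbols :: "nat set"
  start_state :: nat
  halt_state :: nat
  transition :: "nat \<Rightarrow> nat list \<Rightarrow> nat \<times> (nat \<times> move) list"

definition wf_turing_machine :: "turing_machine \<Rightarrow> bool" where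
  "wf_turing_machine M \<longleftrightarrow>
     2 \<le> num_tapes M \<and>
     finite (states M) \<and> start_state M \<in> states M \<and> halt_state M \<in> states M \<and>
     finite (symbols M) \<and> {0, 1, 2} \<subseteq> symbols M \<and>
     (\<forall>q\<in>states M. \<forall>ss. q \<noteq> halt_state M \<and> length ss = num_tapes M \<and> set ss \<subseteq> symbols M \<longrightarrow>
        (case transition M q ss of (q', acts) \<Rightarrow>
           q' \<in> states M \<and> length acts = num_tapes M \<and> fst ` set acts \<subseteq> symbols M))"

type_synonym tape = "(int \<Rightarrow> nat) \<times> int"

type_synonym configuration = "nat \<times> tape list"

definition read_tape :: "tape \<Rightarrow> nat" where
  "read_tape tp = fst tp (snd tp)"

fun move_head :: "move \<Rightarrow> int \<Rightarrow> int" where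
  "move_head MoveLeft h = h - 1"
| "move_head Stay h = h"
| "move_head MoveRight h = h + 1"

definition act_tape :: "nat \<times> move \<Rightarrow> tape \<Rightarrow> tape" where
  "act_tape a tp = ((fst tp)(snd tp := fst a), move_head (snd a) (snd tp))"

definition step :: "turing_machine \<Rightarrow> configuration \<Rightarrow> configuration" where
  "step M c = (case c of (q, tps) \<Rightarrow>
     if q = halt_state M then (q, tps)
     else (case transition M q (map read_tape tps) of (q', acts) \<Rightarrow>
       (q', map2 act_tape acts tps)))"

definition tape_contents :: "bool list \<Rightarrow> int \<Rightarrow> nat" where
  "tape_contents w i =
     (if 0 \<le> i \<and> i < int (length w) then (if w ! nat i then 2 else 1) else 0)"

definition initial_config :: "turing_machine \<Rightarrow> bool list \<Rightarrow> configuration" where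
  "initial_config M x =
     (start_state M, (tape_contents x, 0) # replicate (num_tapes M - 1) (tape_contents [], 0))"

definition outputs_within :: "turing_machine \<Rightarrow> bool list \<Rightarrow> nat \<Rightarrow> bool list \<Rightarrow> bool" where
  "outputs_within M x t y \<longleftrightarrow>
     (case (step M ^^ t) (initial_config M x) of (q, tps) \<Rightarrow>
        q = halt_state M \<and> fst (tps ! 1) = tape_contents y)"


section \<open>Polynomial time\<close>

text \<open>\<open>FP\<close> consists of function problems on bit strings; other function problems enter
  through an encoding of their inputs and answers. No behaviour is prescribed on strings that do
  not encode an input.\<close>

definition FP :: "(bool list, bool list) function_problem set" where
  "FP = {P. \<exists>M. \<exists>p :: nat poly. wf_turing_machine M \<and>
     (\<forall>x\<in>inputs P. \<exists>y\<in>answers P x. outputs_within M x (poly p (length x)) y)}"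

definition encoded_problem :: "('i \<Rightarrow> bool list) \<Rightarrow> ('o \<Rightarrow> bool list) \<Rightarrow>
    ('i, 'o) function_problem \<Rightarrow> (bool list, bool list) function_problem" where
  "encoded_problem ein eout P =
     \<lparr>inputs = ein ` inputs P,
      answers = (\<lambda>x. {eout a |I a. I \<in> inputs P \<and> ein I = x \<and> a \<in> answers P I})\<rparr>"


section \<open>Graphs\<close>

record 'a graph =
  verts :: "'a set"
  edges :: "'a set set"

definition simple_graph :: "'a graph \<Rightarrow> bool" where
  "simple_graph G \<longleftrightarrow> finite (verts G) \<and> (\<forall>e\<in>edges G. e \<subseteq> verts G \<and> card e = 2)"

definition degree :: "'a graph \<Rightarrow> 'a \<Rightarrow> nat" where
  "degree G v = card {e \<in> edges G. v \<in> e}"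

text \<open>The inserted 0 only matters for the graph without vertices.\<close>

definition max_degree :: "'a graph \<Rightarrow> nat" where
  "max_degree G = Max (insert 0 (degree G ` verts G))"

definition dist_Delta_graph :: "'a graph \<Rightarrow> 'a graph \<Rightarrow> ennreal" where
  "dist_Delta_graph G H =
     (if verts G = verts H
      then of_nat (max_degree \<lparr>verts = verts G, edges = sym_diff (edges G) (edges H)\<rparr>)
      else \<infinity>)"

definition dist_Delta :: "'a graph \<times> nat \<Rightarrow> 'a graph \<times> nat \<Rightarrow> ennreal" where
  "dist_Delta I J = (if snd I = snd J then dist_Delta_graph (fst I) (fst J) else \<infinity>)"

definition graph_size :: "'a graph \<times> nat \<Rightarrow> nat" where
  "graph_size I = card (verts (fst I))"

definition independent_set :: "'a graph \<Rightarrow> 'a set \<Rightarrow> bool" where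
  "independent_set G S \<longleftrightarrow> S \<subseteq> verts G \<and> (\<forall>u\<in>S. \<forall>v\<in>S. {u, v} \<notin> edges G)"

text \<open>As inputs of algorithms, graphs on \<open>n\<close> vertices have vertex set \<open>{0..<n}\<close>.\<close>

definition Independent_Set :: "(nat graph \<times> nat, nat set option) function_problem" where
  "Independent_Set =
     \<lparr>inputs = {(G, k). simple_graph G \<and> (\<exists>n. verts G = {0..<n})},
      answers = (\<lambda>(G, k). search_answers {S. independent_set G S \<and> card S = k})\<rparr>"


section \<open>Encodings as bit strings\<close>

text \<open>A graph with \<open>n\<close> vertices is encoded by \<open>n\<close> in unary followed by its adjacency matrix, row by
  row. The number \<open>k\<close> is encoded in binary, least significant bit first, where every bit is
  preceded by a 1 and a final 0 marks the end. A vertex set is encoded by its characteristic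
  vector.\<close>

definition encode_graph :: "nat graph \<Rightarrow> bool list" where
  "encode_graph G = (let n = card (verts G) in
     replicate n True @ [False] @
     concat (map (\<lambda>i. map (\<lambda>j. {i, j} \<in> edges G) [0..<n]) [0..<n]))"

fun encode_nat :: "nat \<Rightarrow> bool list" where
  "encode_nat k = (if k = 0 then [False] else True # odd k # encode_nat (k div 2))"

declare encode_nat.simps [simp del]

definition encode_input :: "nat graph \<times> nat \<Rightarrow> bool list" where
  "encode_input I = encode_graph (fst I) @ encode_nat (snd I)"

fun encode_answer :: "(nat graph \<times> nat) \<times> nat set option \<Rightarrow> bool list" where
  "encode_answer (J, None) = encode_input J @ [False]"
| "encode_answer (J, Some S) =
     encode_input J @ [True] @ map (\<lambda>v. v \<in> S) [0..<card (verts (fst J))]"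

text \<open>The encodings are faithful: they are injective on the relevant sets.\<close>

lemma encode_nat_prefix_free:
  "encode_nat k @ r = encode_nat l @ s \<Longrightarrow> k = l \<and> r = s"
proof (induction k arbitrary: l rule: less_induct)
  case (less k)
  show ?case
  proof (cases "k = 0 \<or> l = 0")
    case True
    then show ?thesis
      using less.prems encode_nat.simps [of k] encode_nat.simps [of l]
      by (cases "k = 0"; cases "l = 0") simp_all
  next
    case False
    then have par: "odd k = odd l"
      and eq: "encode_nat (k div 2) @ r = encode_nat (l div 2) @ s"
      using less.prems encode_nat.simps [of k] encode_nat.simps [of l] by simp_all
    from less.IH [OF _ eq] False have half: "k div 2 = l div 2" and "r = s"
      by auto
    from half par have "k = l" by presburger
    with \<open>r = s\<close> show ?thesis by simp
  qed
qed

lemma replicate_True_prefix_free: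
  "replicate m True @ False # r = replicate n True @ False # s \<Longrightarrow> m = n \<and> r = s"
proof (induction m arbitrary: n)
  case 0
  then show ?case by (cases n) auto
next
  case (Suc m)
  then show ?case by (cases n) auto
qed

lemma concat_map_eq_imp:
  assumes "concat (map f xs) @ r = concat (map g xs) @ s"
    and "\<And>x. x \<in> set xs \<Longrightarrow> length (f x) = length (g x)"
  shows "(\<forall>x\<in>set xs. f x = g x) \<and> r = s"
  using assms by (induction xs) auto

lemma encode_graph_prefix_free:
  assumes "simple_graph G" "simple_graph H" "verts G = {0..<m}" "verts H = {0..<n}"
    and eq: "encode_graph G @ r = encode_graph H @ s"
  shows "G = H \<and> r = s"
proof -
  let ?row = "\<lambda>G n i. map (\<lambda>j. {i, j} \<in> edges G) [0..<n]"
  from eq assms(3,4)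
  have "replicate m True @ False # (concat (map (?row G m) [0..<m]) @ r) =
    replicate n True @ False # (concat (map (?row H n) [0..<n]) @ s)"
    by (simp add: encode_graph_def)
  from replicate_True_prefix_free [OF this]
  have "m = n" and mat: "concat (map (?row G m) [0..<m]) @ r = concat (map (?row H n) [0..<n]) @ s"
    by blast+
  from concat_map_eq_imp [OF mat [unfolded \<open>m = n\<close>]]
  have adj: "\<forall>i\<in>{0..<n}. ?row G n i = ?row H n i" and "r = s"
    by auto
  have iff: "{i, j} \<in> edges G \<longleftrightarrow> {i, j} \<in> edges H" if "i < n" "j < n" for i j
    using adj that by (auto simp: map_eq_conv)
  have "e \<in> edges G \<longleftrightarrow> e \<in> edges H" for e
  proof (cases "e \<subseteq> {0..<n} \<and> card e = 2")
    case True
    then obtain i j where "e = {i, j}" by (auto simp: card_2_iff)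
    then show ?thesis using iff True by auto
  next
    case False
    then show ?thesis using assms(1-4) \<open>m = n\<close> by (auto simp: simple_graph_def)
  qed
  then have "edges G = edges H" by blast
  then show ?thesis using assms(3,4) \<open>m = n\<close> \<open>r = s\<close> by simp
qed

lemma encode_input_prefix_free:
  assumes "I \<in> inputs Independent_Set" "J \<in> inputs Independent_Set"
    and "encode_input I @ r = encode_input J @ s"
  shows "I = J \<and> r = s"
proof -
  obtain G k H l m n where *: "I = (G, k)" "J = (H, l)" "simple_graph G" "simple_graph H"
    "verts G = {0..<m}" "verts H = {0..<n}"
    using assms(1,2) by (auto simp: Independent_Set_def)
  with assms(3) have "encode_graph G @ (encode_nat k @ r) = encode_graph H @ (encode_nat l @ s)"
    by (simp add: encode_input_def)
  from encode_graph_prefix_free [OF *(3-6) this] * show ?thesis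
    by (auto dest: encode_nat_prefix_free)
qed

lemma inj_on_encode_input: "inj_on encode_input (inputs Independent_Set)"
  using encode_input_prefix_free [where r = "[]" and s = "[]"] by (auto intro: inj_onI)

lemma inj_on_encode_answer:
  "inj_on encode_answer
     {(J, a). J \<in> inputs Independent_Set \<and> a \<in> answers Independent_Set J}"
proof (rule inj_onI)
  fix x y
  assume "x \<in> {(J, a). J \<in> inputs Independent_Set \<and> a \<in> answers Independent_Set J}"
    and "y \<in> {(J, a). J \<in> inputs Independent_Set \<and> a \<in> answers Independent_Set J}"
    and xy: "encode_answer x = encode_answer y"
  then obtain G k a H l b where x: "x = ((G, k), a)" and y: "y = ((H, l), b)"
    and J: "(G, k) \<in> inputs Independent_Set" "(H, l) \<in> inputs Independent_Set"
    and ab: "a \<in> answers Independent_Set (G, k)" "b \<in> answers Independent_Set (H, l)"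
    by (cases x; cases y) auto
  from xy x y have eq: "encode_answer ((G, k), a) = encode_answer ((H, l), b)" by simp
  let ?tl = "\<lambda>G a. case a of None \<Rightarrow> [False]
    | Some S \<Rightarrow> True # map (\<lambda>v. v \<in> S) [0..<card (verts (G :: nat graph))]"
  have split: "encode_answer ((F, j), c) = encode_input (F, j) @ ?tl F c" for F j c
    by (cases c) auto
  from eq have "encode_input (G, k) @ ?tl G a = encode_input (H, l) @ ?tl H b"
    unfolding split .
  from encode_input_prefix_free [OF J this]
  have GH: "G = H" "k = l" and tl: "?tl G a = ?tl H b" by auto
  have "a = b"
  proof (cases a)
    case None
    then show ?thesis using tl by (cases b) auto
  next
    case (Some S)
    then obtain T where T: "b = Some T" using tl by (cases b) auto
    obtain n where n: "verts G = {0..<n}" using J by (auto simp: Independent_Set_def)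
    have sub: "S \<subseteq> {0..<n}" "T \<subseteq> {0..<n}"
      using ab Some T GH n
      by (auto simp: Independent_Set_def search_answers_def independent_set_def split: if_splits)
    have "\<forall>v\<in>{0..<n}. v \<in> S \<longleftrightarrow> v \<in> T"
      using tl Some T GH n by (auto simp: map_eq_conv)
    with sub have "S = T" by blast
    then show ?thesis using Some T by simp
  qed
  with GH x y show "x = y" by simp
qed

end

theory Submission
  imports Defs
begin

text \<open>Let \<open>m = k - 1\<close>. If \<open>k = 0\<close>, or \<open>m\<^sup>2 < n\<close> and \<open>k \<le> n\<close>, deleting all edges among the first \<open>k\<close> vertices changes
  each degree by at most \<open>m \<le> \<surd>n\<close> and makes them independent. Otherwise joining all pairs of
  vertices that are congruent modulo \<open>m\<close> covers the graph by \<open>m < k\<close> cliques, so no independent set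
  of size \<open>k\<close> is left, and each degree grows by at most \<open>(n - 1) div m \<le> \<surd>n\<close>. Both changes are
  computed by a Turing machine that uses the heads on unary tapes as counters.\<close>

section \<open>Structured programs for Turing machines\<close>

text \<open>Nothing is searched for: the perturbed graph is built so that its answer is known in
  advance, and the choice between the two perturbations depends only on \<open>n\<close> and
  \<open>k\<close>. Deleting costs a vertex up to \<open>k - 1\<close> edges, adding costs about
  \<open>n / (k - 1)\<close>; both costs meet at the square root of \<open>n\<close>.

  Two points shape the machine. Since \<open>k\<close> comes in binary, it may be exponentially
  larger than \<open>n\<close> and cannot be expanded to unary. But all \<open>k > n\<close> are
  alike, because then no independent set of size \<open>k\<close> exists anyway, so counting
  \<open>k\<close> down for at most \<open>n\<close> rounds is enough. Arithmetic modulo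
  \<open>k - 1\<close> is avoided as well: whether the vertices \<open>i\<close> and
  \<open>j\<close> are congruent depends only on \<open>j - i\<close>. A single tape marked at the
  nonzero multiples of \<open>k - 1\<close>, whose head starts one cell further left in each row,
  decides all added edges.\<close>

datatype com =
    Act "nat list \<Rightarrow> (nat \<times> move) list"
  | Seq com com (infixr ";;" 60)
  | Cond "nat list \<Rightarrow> bool" com com
  | Loop "nat list \<Rightarrow> bool" com

definition idle :: "nat list \<Rightarrow> (nat \<times> move) list" where
  "idle s = map (\<lambda>v. (v, Stay)) s"

text \<open>The states of the machine for a program are stacks of programs that remain to be run.\<close>

fun next_stack :: "com list \<Rightarrow> nat list \<Rightarrow> com list \<times> (nat \<times> move) list" where
  "next_stack [] s = ([], idle s)"
| "next_stack (Act f # r) s = (r, f s)"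
| "next_stack ((a ;; b) # r) s = (a # b # r, idle s)"
| "next_stack (Cond p a b # r) s = ((if p s then a else b) # r, idle s)"
| "next_stack (Loop p a # r) s = (if p s then a # Loop p a # r else r, idle s)"

text \<open>A loop body runs on top of the very stack to which it returns, so iteration creates no
  new stacks and finitely many of them can serve as states. The continuation \<open>r\<close> itself
  is left out: it is where control goes when the program is done.\<close>

fun stacks :: "com \<Rightarrow> com list \<Rightarrow> com list set" where
  "stacks (Act f) r = {Act f # r}"
| "stacks (a ;; b) r = insert ((a ;; b) # r) (stacks a (b # r) \<union> stacks b r)"
| "stacks (Cond p a b) r = insert (Cond p a b # r) (stacks a r \<union> stacks b r)"
| "stacks (Loop p a) r = insert (Loop p a # r) (stacks a (Loop p a # r))"

lemma finite_stacks: "finite (stacks c r)"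
  by (induction c arbitrary: r) auto

lemma head_in_stacks: "c # r \<in> stacks c r"
  by (cases c) auto

lemma next_stack_closed:
  "k \<in> stacks c r \<Longrightarrow> fst (next_stack k s) \<in> insert r (stacks c r)"
proof (induction c arbitrary: r)
  case (Seq a b)
  then show ?case
    using head_in_stacks[of a "b # r"] head_in_stacks[of b r] by fastforce
next
  case (Cond p a b)
  then show ?case
    using head_in_stacks[of a r] head_in_stacks[of b r] by (auto dest!: Cond.IH[where r = r])
next
  case (Loop p a)
  then show ?case
    using head_in_stacks[of a "Loop p a # r"] by fastforce
qed auto

definition acts_ok :: "nat \<Rightarrow> nat list \<Rightarrow> (nat \<times> move) list \<Rightarrow> bool" where
  "acts_ok K s acts \<longleftrightarrow>
     (length s = K \<and> set s \<subseteq> {0, 1, 2} \<longrightarrow> length acts = K \<and> fst ` set acts \<subseteq> {0, 1, 2})"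

fun wf_com :: "nat \<Rightarrow> com \<Rightarrow> bool" where
  "wf_com K (Act f) \<longleftrightarrow> (\<forall>s. acts_ok K s (f s))"
| "wf_com K (a ;; b) \<longleftrightarrow> wf_com K a \<and> wf_com K b"
| "wf_com K (Cond p a b) \<longleftrightarrow> wf_com K a \<and> wf_com K b"
| "wf_com K (Loop p a) \<longleftrightarrow> wf_com K a"

lemma acts_ok_idle: "acts_ok K s (idle s)"
  by (auto simp: acts_ok_def idle_def)

lemma next_stack_acts_ok:
  "wf_com K c \<Longrightarrow> k \<in> stacks c r \<Longrightarrow> acts_ok K s (snd (next_stack k s))"
  by (induction c arbitrary: r) (auto simp: acts_ok_idle)

section \<open>Execution of programs and bounds on its length\<close>

fun stack_step :: "com list \<times> tape list \<Rightarrow> com list \<times> tape list" where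
  "stack_step (k, T) =
     (case next_stack k (map read_tape T) of (k', acts) \<Rightarrow> (k', map2 act_tape acts T))"

lemma act_idle: "map2 act_tape (idle (map read_tape T)) T = T"
  by (induction T) (auto simp: idle_def act_tape_def read_tape_def)

text \<open>One step count works for all continuations \<open>r\<close>, which makes runs
  composable. The number \<open>t\<close> is only an upper bound, so branches of different length
  can share one bound.\<close>

definition runs :: "com \<Rightarrow> tape list \<Rightarrow> nat \<Rightarrow> tape list \<Rightarrow> bool" where
  "runs c T t T' \<longleftrightarrow> (\<exists>t'\<le>t. \<forall>r. (stack_step ^^ t') (c # r, T) = (r, T'))"

lemma runs_mono: "runs c T t U \<Longrightarrow> t \<le> t' \<Longrightarrow> runs c T t' U"
  unfolding runs_def by (meson order_trans)

lemma runs_Act: "runs (Act f) T 1 (map2 act_tape (f (map read_tape T)) T)"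
  unfolding runs_def by (intro exI[of _ 1]) simp

lemma runs_Seq:
  assumes "runs a T t U" and "runs b U t' V"
  shows "runs (a ;; b) T (t + t' + 1) V"
proof -
  obtain i j where i: "i \<le> t" "\<And>r. (stack_step ^^ i) (a # r, T) = (r, U)"
    and j: "j \<le> t'" "\<And>r. (stack_step ^^ j) (b # r, U) = (r, V)"
    using assms unfolding runs_def by metis
  have "(stack_step ^^ Suc (j + i)) ((a ;; b) # r, T) = (r, V)" for r
    by (simp add: funpow_Suc_right funpow_add act_idle i j del: funpow.simps(2))
  then show ?thesis
    unfolding runs_def using i(1) j(1) by (intro exI[of _ "Suc (j + i)"]) auto
qed

lemma runs_Cond:
  assumes "p (map read_tape T) \<Longrightarrow> runs a T t U"
    and "\<not> p (map read_tape T) \<Longrightarrow> runs b T t U"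
  shows "runs (Cond p a b) T (t + 1) U"
proof -
  have "runs (if p (map read_tape T) then a else b) T t U"
    using assms by simp
  then obtain i where i: "i \<le> t"
    "\<And>r. (stack_step ^^ i) ((if p (map read_tape T) then a else b) # r, T) = (r, U)"
    unfolding runs_def by metis
  have "(stack_step ^^ (Suc i)) (Cond p a b # r, T) = (r, U)" for r
    using i(2)[of r] by (simp add: funpow_Suc_right act_idle del: funpow.simps(2))
  then show ?thesis
    unfolding runs_def using i(1) by (intro exI[of _ "Suc i"]) auto
qed

text \<open>The family \<open>S\<close> acts as a loop invariant that names all tapes at every test;
  it fixes the effect of the loop and the number of rounds together. Each round pays one extra step
  for its test, and the final test pays one more.\<close>

lemma runs_Loop:
  assumes "\<And>i. i < n \<Longrightarrow> p (map read_tape (S i))"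
    and "\<And>i. i < n \<Longrightarrow> runs a (S i) t (S (Suc i))"
    and "\<not> p (map read_tape (S n))"
  shows "runs (Loop p a) (S 0) (n * (t + 1) + 1) (S n)"
  using assms
proof (induction n arbitrary: S)
  case 0
  have "(stack_step ^^ 1) (Loop p a # r, S 0) = (r, S 0)" for r
    using 0(3) by (simp add: act_idle)
  then show ?case
    unfolding runs_def by (intro exI[of _ 1]) auto
next
  case (Suc n)
  have "runs (Loop p a) (S (Suc 0)) (n * (t + 1) + 1) (S (Suc n))"
    by (rule Suc.IH[of "\<lambda>i. S (Suc i)"]) (use Suc.prems in auto)
  moreover have "runs a (S 0) t (S (Suc 0))"
    using Suc.prems by auto
  ultimately obtain i j where i: "i \<le> t" "\<And>r. (stack_step ^^ i) (a # r, S 0) = (r, S (Suc 0))"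
    and j: "j \<le> n * (t + 1) + 1"
      "\<And>r. (stack_step ^^ j) (Loop p a # r, S (Suc 0)) = (r, S (Suc n))"
    unfolding runs_def by metis
  have p: "p (map read_tape (S 0))"
    using Suc.prems by auto
  have "(stack_step ^^ (Suc (j + i))) (Loop p a # r, S 0) = (r, S (Suc n))" for r
    by (simp add: funpow_Suc_right funpow_add p act_idle i j del: funpow.simps(2))
  then show ?case
    unfolding runs_def using i(1) j(1) by (intro exI[of _ "Suc (j + i)"]) auto
qed

section \<open>From programs to Turing machines\<close>

lemma FP_I:
  fixes bound :: "nat poly"
  assumes wf: "wf_com K c" and K: "2 \<le> K"
    and run: "\<And>x. x \<in> inputs P \<Longrightarrow>
      \<exists>y\<in>answers P x. \<exists>T. runs c ((tape_contents x, 0) # replicate (K - 1) (tape_contents [], 0))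
        (poly bound (length x)) T \<and> fst (T ! 1) = tape_contents y"
  shows "P \<in> FP"
proof -
  define S where "S = insert [] (stacks c [])"
  have "finite S" by (simp add: S_def finite_stacks)
  then obtain code :: "com list \<Rightarrow> nat" where inj: "inj_on code S"
    using finite_imp_inj_to_nat_seg by metis
  define M where "M = \<lparr>num_tapes = K, states = code ` S, symbols = {0, 1, 2},
    start_state = code [c], halt_state = code [],
    transition = (\<lambda>q s. map_prod code id (next_stack (inv_into S code q) s))\<rparr>"
  have closed: "fst (next_stack k s) \<in> S" if "k \<in> S" for k s
    using that next_stack_closed[of k c "[]" s] by (auto simp: S_def)
  have ok: "acts_ok K s (snd (next_stack k s))" if "k \<in> S" for k s
    using that next_stack_acts_ok[OF wf] acts_ok_idle by (auto simp: S_def)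
  have start: "[c] \<in> S" by (simp add: S_def head_in_stacks)
  have "wf_turing_machine M"
    unfolding wf_turing_machine_def
  proof (intro conjI ballI allI impI)
    fix q s
    assume q: "q \<in> states M"
      and s: "q \<noteq> halt_state M \<and> length s = num_tapes M \<and> set s \<subseteq> symbols M"
    obtain k where k: "k \<in> S" "q = code k" using q by (auto simp: M_def)
    show "case transition M q s of (q', acts) \<Rightarrow>
           q' \<in> states M \<and> length acts = num_tapes M \<and> fst ` set acts \<subseteq> symbols M"
      using closed[OF k(1), of s] ok[OF k(1), of s] s inj k
      by (cases "next_stack k s") (auto simp: M_def acts_ok_def)
  qed (use K start \<open>finite S\<close> in \<open>auto simp: M_def S_def\<close>)
  \<comment> \<open>The numbering commutes with single steps. At the empty stack both sides stand
    still; at any other stack, injectivity of \<open>code\<close> keeps the state apart from the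
    halting state.\<close>
  moreover have step: "step M (code k, T) = map_prod code id (stack_step (k, T))" if "k \<in> S" for k T
  proof (cases "k = []")
    case True
    then show ?thesis by (simp add: step_def M_def act_idle)
  next
    case False
    then have "code k \<noteq> code []"
      using inj_on_eq_iff[OF inj that, of "[]"] by (simp add: S_def)
    then show ?thesis
      using inj that
      by (cases "next_stack k (map read_tape T)") (simp add: step_def M_def)
  qed
  have steps: "(step M ^^ i) (code [c], T) = map_prod code id ((stack_step ^^ i) ([c], T)) \<and>
      fst ((stack_step ^^ i) ([c], T)) \<in> S" for i T
  proof (induction i)
    case 0
    then show ?case using start by simp
  next
    case (Suc i)
    obtain k U where kU: "(stack_step ^^ i) ([c], T) = (k, U)" by fastforce
    then have "k \<in> S" using Suc by simp
    then show ?case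
      using Suc kU step[of k U] closed[of k "map read_tape U"]
      by (auto split: prod.splits)
  qed
  have "\<exists>y\<in>answers P x. outputs_within M x (poly bound (length x)) y" if x: "x \<in> inputs P" for x
  proof -
    let ?T = "(tape_contents x, 0) # replicate (K - 1) (tape_contents [], 0)"
    obtain y T i where y: "y \<in> answers P x" and T: "fst (T ! 1) = tape_contents y"
      and i: "i \<le> poly bound (length x)" "(stack_step ^^ i) ([c], ?T) = ([], T)"
      using run[OF x] unfolding runs_def by blast
    \<comment> \<open>\<open>outputs_within\<close> looks at the configuration after exactly the
      given number of steps, so a shorter run is padded with idle steps.\<close>
    have halted: "(stack_step ^^ j) ([], T) = ([], T)" for j
      by (induction j) (auto simp: act_idle)
    have "(stack_step ^^ poly bound (length x)) ([c], ?T) = ([], T)"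
      using i halted[of "poly bound (length x) - i"]
        funpow_add[of "poly bound (length x) - i" i stack_step] by simp
    then have "outputs_within M x (poly bound (length x)) y"
      using steps[of "poly bound (length x)" ?T] T
      by (simp add: outputs_within_def initial_config_def M_def)
    with y show ?thesis by blast
  qed
  ultimately show ?thesis
    unfolding FP_def by blast
qed


section \<open>Reading the input\<close>

abbreviation "R \<equiv> MoveRight"
abbreviation "L \<equiv> MoveLeft"

definition shift :: "nat \<Rightarrow> move \<Rightarrow> com" where
  "shift i d = Act (\<lambda>s. (idle s)[i := (s ! i, d)])"

text \<open>The first move leaves the blank behind the word in case the head stands there; the loop
  ends on the blank at position -1, and the last move goes back to 0.\<close>

definition rewind :: "nat \<Rightarrow> com" where
  "rewind i = shift i L ;; Loop (\<lambda>s. s ! i \<noteq> 0) (shift i L) ;; shift i R"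

lemma acts_ok_update:
  assumes "acts_ok K s xs" and "length s = K \<Longrightarrow> set s \<subseteq> {0, 1, 2} \<Longrightarrow> v \<in> {0, 1, 2}"
  shows "acts_ok K s (xs[i := (v, m)])"
  using assms set_update_subset_insert[of xs i "(v, m)"] unfolding acts_ok_def by fastforce

lemma acts_ok_copy: "acts_ok K s xs \<Longrightarrow> i < K \<Longrightarrow> acts_ok K s (xs[j := (s ! i, m)])"
  by (rule acts_ok_update) (auto dest!: nth_mem)

lemma wf_shift: "i < K \<Longrightarrow> wf_com K (shift i d)"
  by (simp add: shift_def acts_ok_copy acts_ok_idle)

lemma wf_rewind: "i < K \<Longrightarrow> wf_com K (rewind i)"
  by (simp add: rewind_def wf_shift)

lemma runs_ActI: "map2 act_tape (f (map read_tape T)) T = U \<Longrightarrow> runs (Act f) T 1 U"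
  using runs_Act by metis

lemma runs_shift:
  assumes "i < length T"
  shows "runs (shift i d) T 1 (T[i := (fst (T ! i), move_head d (snd (T ! i)))])"
  unfolding shift_def
proof (rule runs_ActI, rule nth_equalityI)
  fix j
  assume "j < length (map2 act_tape ((idle (map read_tape T))[i := (map read_tape T ! i, d)]) T)"
  then show "map2 act_tape ((idle (map read_tape T))[i := (map read_tape T ! i, d)]) T ! j =
      T[i := (fst (T ! i), move_head d (snd (T ! i)))] ! j"
    using assms
    by (cases "j = i") (auto simp: idle_def act_tape_def read_tape_def nth_list_update)
qed (simp add: idle_def)

lemma contents_nth:
  "tape_contents w (int p) = (if p < length w then if w ! p then 2 else 1 else 0)"
  by (simp add: tape_contents_def)

lemma contents_snoc: "(tape_contents w)(int (length w) := (if b then 2 else 1)) = tape_contents (w @ [b])"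
  by (rule ext) (auto simp: tape_contents_def nth_append nat_less_iff)

lemma contents_update:
  "p < length w \<Longrightarrow>
    (tape_contents w)(int p := (if b then 2 else 1)) = tape_contents (w[p := b])"
  by (rule ext) (auto simp: tape_contents_def nth_list_update nat_less_iff)

lemma runs_rewind:
  assumes "T ! i = (tape_contents w, int p)" "p \<le> length w" "i < length T"
  shows "runs (rewind i) T (2 * p + 5) (T[i := (tape_contents w, 0)])"
proof -
  define S where "S j = T[i := (tape_contents w, int p - 1 - int j)]" for j
  have 1: "runs (shift i L) T 1 (S 0)"
    using runs_shift[of i T L] assms by (simp add: S_def)
  have 2: "runs (Loop (\<lambda>s. s ! i \<noteq> 0) (shift i L)) (S 0) (p * (1 + 1) + 1) (S p)"
  proof (rule runs_Loop)
    fix j assume j: "j < p"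
    have "int p - 1 - int j = int (p - 1 - j)" using j by simp
    then show "map read_tape (S j) ! i \<noteq> 0"
      using assms j by (simp add: S_def read_tape_def contents_nth del: of_nat_diff)
    show "runs (shift i L) (S j) 1 (S (Suc j))"
      using runs_shift[of i "S j" L] assms by (simp add: S_def algebra_simps)
  next
    show "\<not> map read_tape (S p) ! i \<noteq> 0"
      using assms by (simp add: S_def read_tape_def tape_contents_def)
  qed
  have 3: "runs (shift i R) (S p) 1 (T[i := (tape_contents w, 0)])"
    using runs_shift[of i "S p" R] assms by (simp add: S_def)
  show ?thesis
    unfolding rewind_def using runs_Seq[OF 1 runs_Seq[OF 2 3]] by (rule runs_mono) simp
qed

text \<open>Tape 0 holds the input and tape 1 the output. Tapes 2 and 3 have length \<open>n\<close>; they serve as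
  row and column counters, and later their first \<open>k\<close> cells contain a 2. Tape 4 is the binary counter
  for \<open>k\<close>. In row \<open>i\<close> and column \<open>j\<close> the head on tape 5 is at \<open>j - i\<close>, where a 2 asks for an edge.
  A 2 on tape 6 selects the deletion of edges.\<close>

definition read_input :: com where
  "read_input =
     Loop (\<lambda>s. s ! 0 = 2) (Act (\<lambda>s. (idle s)[0 := (s ! 0, R), 2 := (1, R), 3 := (1, R)])) ;;
     shift 0 R ;; rewind 2 ;; rewind 3 ;;
     Loop (\<lambda>s. s ! 2 \<noteq> 0)
       (Loop (\<lambda>s. s ! 3 \<noteq> 0) (Act (\<lambda>s. (idle s)[0 := (s ! 0, R), 3 := (s ! 3, R)])) ;;
        rewind 3 ;; shift 2 R) ;;
     rewind 2 ;;
     Loop (\<lambda>s. s ! 0 = 2)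
       (shift 0 R ;; Act (\<lambda>s. (idle s)[0 := (s ! 0, R), 4 := (s ! 0, R)])) ;;
     rewind 4 ;; rewind 0"

lemma wf_read_input: "wf_com 7 read_input"
  by (auto simp: read_input_def intro!: wf_shift wf_rewind acts_ok_update acts_ok_copy acts_ok_idle)

text \<open>Only the layout of an encoded input is fixed, and the \<open>n * n\<close> matrix bits
  stay arbitrary, so the machine can be analysed without graphs. Here \<open>m\<close> is the
  position where the encoded number starts; it has nothing to do with \<open>k - 1\<close>.\<close>

locale input_string =
  fixes x :: "bool list" and n :: nat and bs :: "bool list" and m :: nat
  assumes x_unary: "\<And>i. i < n \<Longrightarrow> x ! i"
    and x_sep: "\<not> x ! n"
    and m_eq: "m = Suc n + n * n"
    and x_cont: "\<And>i. i < length bs \<Longrightarrow> x ! (m + 2 * i)"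
    and x_bits: "\<And>i. i < length bs \<Longrightarrow> x ! Suc (m + 2 * i) = bs ! i"
    and x_end: "\<not> x ! (m + 2 * length bs)"
    and length_x: "length x = Suc (m + 2 * length bs)"
begin

lemma runs_read_input:
  "runs read_input
     [(tape_contents x, 0), a1, (tape_contents [], 0), (tape_contents [], 0), (tape_contents [], 0), a5, a6]
     (100 * length x)
     [(tape_contents x, 0), a1, (tape_contents (replicate n False), 0),
      (tape_contents (replicate n False), 0), (tape_contents bs, 0), a5, a6]"
proof -
  let ?r = "\<lambda>j. tape_contents (replicate j False)"
  \<comment> \<open>\<open>p\<close>, \<open>j2\<close>, \<open>j3\<close>, \<open>j4\<close> are
    head positions; \<open>i2\<close>, \<open>i3\<close>, \<open>i4\<close> are the lengths of what
    the tapes 2, 3, 4 hold so far.\<close>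
  let ?S = "\<lambda>p i2 j2 i3 j3 i4 j4. [(tape_contents x, int p), a1, (?r i2, int j2), (?r i3, int j3),
    (tape_contents (take i4 bs), int j4), a5, a6]"
  have snoc: "(?r i)(int i := Suc 0) = ?r (Suc i)" for i
    using contents_snoc[of "replicate i False" False] by (simp add: replicate_append_same)
  have 1: "runs (Loop (\<lambda>s. s ! 0 = 2) (Act (\<lambda>s. (idle s)[0 := (s ! 0, R), 2 := (1, R), 3 := (1, R)])))
     (?S 0 0 0 0 0 0 0) (n * (1 + 1) + 1) (?S n n n n n 0 0)"
    apply (rule runs_Loop[where S = "\<lambda>i. ?S i i i i i 0 0"])
      apply (simp add: read_tape_def contents_nth x_unary length_x m_eq)
     apply (rule runs_ActI)
     apply (simp add: act_tape_def read_tape_def idle_def snoc)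
    apply (simp add: read_tape_def contents_nth x_sep)
    done
  have 2: "runs (shift 0 R) (?S n n n n n 0 0) 1 (?S (Suc n) n n n n 0 0)"
    by (rule back_subst[of "runs _ _ _", OF runs_shift]) auto
  have 3: "runs (rewind 2) (?S (Suc n) n n n n 0 0) (2 * n + 5) (?S (Suc n) n 0 n n 0 0)"
    by (rule back_subst[of "runs _ _ _", OF runs_rewind]) auto
  have 4: "runs (rewind 3) (?S (Suc n) n 0 n n 0 0) (2 * n + 5) (?S (Suc n) n 0 n 0 0 0)"
    by (rule back_subst[of "runs _ _ _", OF runs_rewind]) auto
  \<comment> \<open>The matrix bits carry no end mark, so they can only be skipped by counting: tape
    2 counts the rows, tape 3 the columns.\<close>
  have 5: "runs (Loop (\<lambda>s. s ! 2 \<noteq> 0)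
       (Loop (\<lambda>s. s ! 3 \<noteq> 0) (Act (\<lambda>s. (idle s)[0 := (s ! 0, R), 3 := (s ! 3, R)])) ;;
        rewind 3 ;; shift 2 R))
     (?S (Suc n) n 0 n 0 0 0) (n * ((n * (1 + 1) + 1 + (2 * n + 5 + 1 + 1) + 1) + 1) + 1) (?S m n n n 0 0 0)"
    (is "runs (Loop _ (?c ;; _ ;; _)) _ _ _")
  proof -
    have "runs (Loop (\<lambda>s. s ! 2 \<noteq> 0) (?c ;; rewind 3 ;; shift 2 R))
      (?S (Suc n + 0 * n) n 0 n 0 0 0) (n * ((n * (1 + 1) + 1 + (2 * n + 5 + 1 + 1) + 1) + 1) + 1)
      (?S (Suc n + n * n) n n n 0 0 0)"
    proof (rule runs_Loop[where S = "\<lambda>i. ?S (Suc n + i * n) n i n 0 0 0"])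
      fix i assume i: "i < n"
      show "map read_tape (?S (Suc n + i * n) n i n 0 0 0) ! 2 \<noteq> 0"
        using i by (simp add: read_tape_def contents_nth)
      have "runs ?c (?S (Suc n + i * n + 0) n i n 0 0 0) (n * (1 + 1) + 1)
        (?S (Suc n + i * n + n) n i n n 0 0)"
        apply (rule runs_Loop[where S = "\<lambda>j. ?S (Suc n + i * n + j) n i n j 0 0"])
          apply (simp add: read_tape_def contents_nth)
         apply (rule runs_ActI)
         apply (simp add: act_tape_def read_tape_def idle_def snoc)
        apply (simp add: read_tape_def contents_nth)
        done
      moreover have "runs (rewind 3) (?S (Suc n + i * n + n) n i n n 0 0) (2 * n + 5)
        (?S (Suc n + i * n + n) n i n 0 0 0)"
        by (rule back_subst[of "runs _ _ _", OF runs_rewind]) auto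
      moreover have "runs (shift 2 R) (?S (Suc n + i * n + n) n i n 0 0 0) 1
        (?S (Suc n + i * n + n) n (Suc i) n 0 0 0)"
        by (rule back_subst[of "runs _ _ _", OF runs_shift]) auto
      ultimately have "runs (?c ;; rewind 3 ;; shift 2 R) (?S (Suc n + i * n + 0) n i n 0 0 0)
          (n * (1 + 1) + 1 + (2 * n + 5 + 1 + 1) + 1) (?S (Suc n + i * n + n) n (Suc i) n 0 0 0)"
        by (intro runs_Seq)
      then show "runs (?c ;; rewind 3 ;; shift 2 R) (?S (Suc n + i * n) n i n 0 0 0)
          (n * (1 + 1) + 1 + (2 * n + 5 + 1 + 1) + 1) (?S (Suc n + Suc i * n) n (Suc i) n 0 0 0)"
        by (simp add: algebra_simps)
    qed (simp add: read_tape_def contents_nth)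
    then show ?thesis by (simp add: m_eq)
  qed
  have 6: "runs (rewind 2) (?S m n n n 0 0 0) (2 * n + 5) (?S m n 0 n 0 0 0)"
    by (rule back_subst[of "runs _ _ _", OF runs_rewind]) auto
  \<comment> \<open>Each round passes a continuation bit and copies the digit behind it, until the
    terminating 0 shows up.\<close>
  have 7: "runs (Loop (\<lambda>s. s ! 0 = 2)
       (shift 0 R ;; Act (\<lambda>s. (idle s)[0 := (s ! 0, R), 4 := (s ! 0, R)])))
     (?S m n 0 n 0 0 0) (length bs * ((1 + 1 + 1) + 1) + 1)
     (?S (m + 2 * length bs) n 0 n 0 (length bs) (length bs))"
  proof -
    have "runs (Loop (\<lambda>s. s ! 0 = 2)
       (shift 0 R ;; Act (\<lambda>s. (idle s)[0 := (s ! 0, R), 4 := (s ! 0, R)])))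
     (?S (m + 2 * 0) n 0 n 0 0 0) (length bs * ((1 + 1 + 1) + 1) + 1)
     (?S (m + 2 * length bs) n 0 n 0 (length bs) (length bs))"
    proof (rule runs_Loop[where S = "\<lambda>i. ?S (m + 2 * i) n 0 n 0 i i"])
      fix i assume i: "i < length bs"
      show "map read_tape (?S (m + 2 * i) n 0 n 0 i i) ! 0 = 2"
        using i x_cont[of i] contents_nth[of x "m + 2 * i"] by (simp add: read_tape_def length_x)
      have snoc': "(tape_contents (take i bs))(int i := (if bs ! i then 2 else Suc 0)) =
          tape_contents (take (Suc i) bs)"
        using contents_snoc[of "take i bs" "bs ! i"] i
        by (cases "bs ! i") (simp_all add: take_Suc_conv_app_nth)
      have rd: "tape_contents x (1 + (int m + 2 * int i)) = (if bs ! i then 2 else Suc 0)"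
        using contents_nth[of x "Suc (m + 2 * i)"] x_bits[of i] i length_x by (simp add: algebra_simps)
      have "runs (shift 0 R) (?S (m + 2 * i) n 0 n 0 i i) 1 (?S (Suc (m + 2 * i)) n 0 n 0 i i)"
        by (rule back_subst[of "runs _ _ _", OF runs_shift]) auto
      moreover have "runs (Act (\<lambda>s. (idle s)[0 := (s ! 0, R), 4 := (s ! 0, R)]))
        (?S (Suc (m + 2 * i)) n 0 n 0 i i) 1 (?S (m + 2 * Suc i) n 0 n 0 (Suc i) (Suc i))"
        apply (rule runs_ActI)
        apply (simp add: act_tape_def read_tape_def idle_def rd snoc' fun_upd_idem)
        done
      ultimately show "runs (shift 0 R ;; Act (\<lambda>s. (idle s)[0 := (s ! 0, R), 4 := (s ! 0, R)]))
        (?S (m + 2 * i) n 0 n 0 i i) (1 + 1 + 1) (?S (m + 2 * Suc i) n 0 n 0 (Suc i) (Suc i))"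
        by (rule runs_Seq)
    qed (use x_end contents_nth[of x "m + 2 * length bs"] in \<open>auto simp add: read_tape_def\<close>)
    then show ?thesis by simp
  qed
  have 8: "runs (rewind 4) (?S (m + 2 * length bs) n 0 n 0 (length bs) (length bs))
     (2 * length bs + 5) (?S (m + 2 * length bs) n 0 n 0 (length bs) 0)"
    by (rule back_subst[of "runs _ _ _", OF runs_rewind]) auto
  have 9: "runs (rewind 0) (?S (m + 2 * length bs) n 0 n 0 (length bs) 0)
     (2 * (m + 2 * length bs) + 5) (?S 0 n 0 n 0 (length bs) 0)"
    by (rule back_subst[of "runs _ _ _", OF runs_rewind]) (auto simp: length_x)
  have "runs read_input (?S 0 0 0 0 0 0 0) (100 * length x) (?S 0 n 0 n 0 (length bs) 0)"
    unfolding read_input_def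
    by (rule runs_mono[OF runs_Seq[OF 1 runs_Seq[OF 2 runs_Seq[OF 3 runs_Seq[OF 4 runs_Seq[OF 5
      runs_Seq[OF 6 runs_Seq[OF 7 runs_Seq[OF 8 9]]]]]]]]])
      (simp add: length_x m_eq algebra_simps)
  then show ?thesis by simp
qed

end

section \<open>Marking the first k cells by counting down\<close>

text \<open>Borrowing turns the zeros below the lowest one into ones, so the borrowing loop stops at a 2 iff
  the counter was positive. On zero the value \<open>dec\<close> is not a predecessor.\<close>

fun dec :: "bool list \<Rightarrow> bool list" where
  "dec [] = []"
| "dec (b # bs) = (if b then False # bs else True # dec bs)"

abbreviation val :: "bool list \<Rightarrow> nat" where
  "val \<equiv> horner_sum of_bool 2"

abbreviation lowest_one :: "bool list \<Rightarrow> nat" where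
  "lowest_one bs \<equiv> length (takeWhile Not bs)"

text \<open>This is the counter in the middle of a decrement: the borrow has passed \<open>j\<close>
  low zeros and turned them into ones, and the one that pays for it is still to be cleared.\<close>

definition flip_zeros :: "nat \<Rightarrow> bool list \<Rightarrow> bool list" where
  "flip_zeros j bs = replicate j True @ drop j bs"

lemma lowest_one_less_iff: "lowest_one bs < length bs \<longleftrightarrow> 0 < val bs"
  by (induction bs) auto

lemma lowest_one_le: "lowest_one bs \<le> length bs"
  by (rule length_takeWhile_le)

lemma val_dec: "0 < val bs \<Longrightarrow> val (dec bs) = val bs - 1"
  by (induction bs) auto

lemma length_dec: "length (dec bs) = length bs"
  by (induction bs) auto

lemma val_dec_funpow: "i \<le> val bs \<Longrightarrow> val ((dec ^^ i) bs) = val bs - i"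
  by (induction i) (auto simp: val_dec)

lemma length_dec_funpow: "length ((dec ^^ i) bs) = length bs"
  by (induction i) (auto simp: length_dec)

lemma flip_zeros_dec:
  "lowest_one bs < length bs \<Longrightarrow> (flip_zeros (lowest_one bs) bs)[lowest_one bs := False] = dec bs"
  by (induction bs) (auto simp: flip_zeros_def)

lemma length_flip_zeros: "j \<le> length bs \<Longrightarrow> length (flip_zeros j bs) = length bs"
  by (simp add: flip_zeros_def)

lemma flip_zeros_nth: "j \<le> i \<Longrightarrow> i < length bs \<Longrightarrow> flip_zeros j bs ! i = bs ! i"
  by (simp add: flip_zeros_def nth_append)

lemma flip_zeros_update:
  "j < length bs \<Longrightarrow> (flip_zeros j bs)[j := True] = flip_zeros (Suc j) bs"
  by (simp add: flip_zeros_def list_update_append Cons_nth_drop_Suc[symmetric] replicate_append_same)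

section \<open>The counting program and its running time\<close>

definition skip_zeros :: com where
  "skip_zeros = Loop (\<lambda>s. s ! 4 = 1) (Act (\<lambda>s. (idle s)[4 := (2, R)]))"

text \<open>Each decrement is split across the loop test. \<open>skip_zeros\<close> borrows ahead of
  the test, so that the symbol under head 4 shows whether the counter is positive; the body then
  clears the one found there and prepares the next test. Tape 2 caps the number of rounds at
  \<open>n\<close>, however large \<open>k\<close> is.\<close>

definition mark :: com where
  "mark =
     skip_zeros ;;
     Loop (\<lambda>s. s ! 2 \<noteq> 0 \<and> s ! 4 = 2)
       (Act (\<lambda>s. (idle s)[4 := (1, Stay), 2 := (2, R), 3 := (2, R)]) ;; rewind 4 ;; skip_zeros) ;;
     rewind 2 ;; rewind 3"

lemma wf_mark: "wf_com 7 mark"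
  by (auto simp: mark_def skip_zeros_def intro!: wf_rewind acts_ok_update acts_ok_idle)

lemma runs_skip_zeros:
  "runs skip_zeros [a0, a1, a2, a3, (tape_contents bs, 0), a5, a6] (2 * length bs + 1)
     [a0, a1, a2, a3, (tape_contents (flip_zeros (lowest_one bs) bs), int (lowest_one bs)), a5, a6]"
proof -
  let ?S = "\<lambda>j. [a0, a1, a2, a3, (tape_contents (flip_zeros j bs), int j), a5, a6]"
  have "runs skip_zeros (?S 0) (lowest_one bs * (1 + 1) + 1) (?S (lowest_one bs))"
    unfolding skip_zeros_def
  proof (rule runs_Loop)
    fix j assume j: "j < lowest_one bs"
    then have less: "j < length bs"
      using lowest_one_le order_less_le_trans by blast
    have "takeWhile Not bs ! j \<in> set (takeWhile Not bs)" using j by (rule nth_mem)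
    then have "\<not> bs ! j" using j by (metis set_takeWhileD takeWhile_nth)
    then show "map read_tape (?S j) ! 4 = 1"
      using less by (simp add: read_tape_def contents_nth length_flip_zeros flip_zeros_nth)
    have "(tape_contents (flip_zeros j bs))(int j := 2) = tape_contents (flip_zeros (Suc j) bs)"
      using contents_update[of j "flip_zeros j bs" True] less
      by (simp add: length_flip_zeros flip_zeros_update)
    then show "runs (Act (\<lambda>s. (idle s)[4 := (2, R)])) (?S j) 1 (?S (Suc j))"
      by (intro runs_ActI) (simp add: act_tape_def read_tape_def idle_def)
  next
    show "map read_tape (?S (lowest_one bs)) ! 4 \<noteq> 1"
      using nth_length_takeWhile[of Not bs]
      by (simp add: read_tape_def contents_nth length_flip_zeros flip_zeros_nth lowest_one_le)
  qed
  then show ?thesis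
    using runs_mono lowest_one_le[of bs] by (fastforce simp: flip_zeros_def)
qed

text \<open>For \<open>k \<le> n\<close> the 2s form a unary copy of \<open>k\<close>; the same word
  is the characteristic vector of \<open>{0..<k}\<close> with which a positive answer ends.\<close>

definition marks :: "nat \<Rightarrow> nat \<Rightarrow> int \<Rightarrow> nat" where
  "marks n k = tape_contents (map (\<lambda>v. v < k) [0..<n])"

lemma marks_nth: "marks n k (int p) = (if p < n then if p < k then 2 else 1 else 0)"
  by (simp add: marks_def contents_nth)

lemma marks_0: "marks n 0 = tape_contents (replicate n False)"
  by (simp add: marks_def map_replicate_const)

lemma marks_update: "i < n \<Longrightarrow> (marks n i)(int i := 2) = marks n (Suc i)"
  by (rule ext) (auto simp: marks_def tape_contents_def)

lemma marks_min: "marks n (min n k) = marks n k"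
  by (rule ext) (auto simp: marks_def tape_contents_def)

lemma runs_rewind_marks:
  assumes "T ! i = (marks n k, int p)" "p \<le> n" "i < length T"
  shows "runs (rewind i) T (2 * p + 5) (T[i := (marks n k, 0)])"
  using assms by (auto simp: marks_def intro: runs_rewind)

text \<open>The loop stops because the counter or the cells run out. The symbol finally scanned on
  tape 4 tells which of the two happened, and so passes the comparison of \<open>n\<close> with
  \<open>k\<close> on to \<open>choose_mode\<close>.\<close>

lemma runs_mark:
  "\<exists>a4. runs mark
     [a0, a1, (marks n 0, 0), (marks n 0, 0), (tape_contents bs, 0), a5, a6]
     ((n + 1) * (4 * length bs + 20))
     [a0, a1, (marks n (val bs), 0), (marks n (val bs), 0), a4, a5, a6] \<and>
     (read_tape a4 = 2 \<longleftrightarrow> n < val bs)"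
proof -
  define N where "N = min n (val bs)"
  let ?len = "length bs"
  let ?dec = "\<lambda>i. (dec ^^ i) bs"
  let ?a4 = "\<lambda>i. (tape_contents (flip_zeros (lowest_one (?dec i)) (?dec i)), int (lowest_one (?dec i)))"
  let ?S = "\<lambda>i. [a0, a1, (marks n i, int i), (marks n i, int i), ?a4 i, a5, a6]"
  have read: "read_tape (?a4 i) = 2 \<longleftrightarrow> i < val bs" if "i \<le> val bs" for i
  proof -
    have "?dec i ! lowest_one (?dec i)" if "lowest_one (?dec i) < ?len"
      using nth_length_takeWhile[of Not "?dec i"] that by (simp add: length_dec_funpow)
    moreover have "i < val bs \<longleftrightarrow> lowest_one (?dec i) < ?len"
      using lowest_one_less_iff[of "?dec i"] that by (simp add: val_dec_funpow length_dec_funpow)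
    ultimately show ?thesis
      using lowest_one_le[of "?dec i"]
      by (auto simp: read_tape_def contents_nth length_flip_zeros flip_zeros_nth length_dec_funpow)
  qed
  have 1: "runs skip_zeros
     [a0, a1, (marks n 0, int 0), (marks n 0, int 0), (tape_contents bs, 0), a5, a6] (2 * ?len + 1) (?S 0)"
    using runs_skip_zeros[of a0 a1 "(marks n 0, 0)" "(marks n 0, 0)" bs a5 a6] by simp
  have 2: "runs (Loop (\<lambda>s. s ! 2 \<noteq> 0 \<and> s ! 4 = 2)
       (Act (\<lambda>s. (idle s)[4 := (1, Stay), 2 := (2, R), 3 := (2, R)]) ;; rewind 4 ;; skip_zeros))
     (?S 0) (N * ((1 + (2 * ?len + 5 + (2 * ?len + 1) + 1) + 1) + 1) + 1) (?S N)"
  proof (rule runs_Loop)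
    fix i assume "i < N"
    then have i: "i < n" "i < val bs" "i \<le> val bs" by (auto simp: N_def)
    show "map read_tape (?S i) ! 2 \<noteq> 0 \<and> map read_tape (?S i) ! 4 = 2"
      using i read[of i] by (simp add: read_tape_def marks_nth)
    have less: "lowest_one (?dec i) < ?len"
      using lowest_one_less_iff[of "?dec i"] i by (simp add: val_dec_funpow length_dec_funpow)
    have one_to_zero: "(fst (?a4 i))(snd (?a4 i) := Suc 0) = tape_contents (?dec (Suc i))"
      using contents_update[of "lowest_one (?dec i)" "flip_zeros (lowest_one (?dec i)) (?dec i)" False]
        flip_zeros_dec[of "?dec i"] less
      by (simp add: length_flip_zeros length_dec_funpow)
    let ?T = "\<lambda>p. [a0, a1, (marks n (Suc i), int (Suc i)), (marks n (Suc i), int (Suc i)),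
      (tape_contents (?dec (Suc i)), int p), a5, a6]"
    have "runs (Act (\<lambda>s. (idle s)[4 := (1, Stay), 2 := (2, R), 3 := (2, R)])) (?S i) 1
        (?T (lowest_one (?dec i)))"
      using i one_to_zero marks_update[of i n]
      by (intro runs_ActI) (simp add: act_tape_def read_tape_def idle_def del: funpow.simps)
    moreover have "runs (rewind 4) (?T (lowest_one (?dec i))) (2 * ?len + 5) (?T 0)"
      by (rule runs_mono, rule back_subst[of "runs _ _ _", OF runs_rewind])
        (use less in \<open>auto simp: length_dec_funpow simp del: funpow.simps\<close>)
    moreover have "runs skip_zeros (?T 0) (2 * ?len + 1) (?S (Suc i))"
      using runs_skip_zeros[of a0 a1 _ _ "?dec (Suc i)"]
      by (simp add: length_dec_funpow del: funpow.simps)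
    ultimately show "runs
      (Act (\<lambda>s. (idle s)[4 := (1, Stay), 2 := (2, R), 3 := (2, R)]) ;; rewind 4 ;; skip_zeros)
      (?S i) (1 + (2 * ?len + 5 + (2 * ?len + 1) + 1) + 1) (?S (Suc i))"
      by (intro runs_Seq)
  next
    show "\<not> (map read_tape (?S N) ! 2 \<noteq> 0 \<and> map read_tape (?S N) ! 4 = 2)"
      using read[of N] by (auto simp: read_tape_def marks_nth N_def)
  qed
  let ?T = "\<lambda>p q. [a0, a1, (marks n N, int p), (marks n N, int q), ?a4 N, a5, a6]"
  have 3: "runs (rewind 2) (?S N) (2 * N + 5) (?T 0 N)"
    by (rule back_subst[of "runs _ _ _", OF runs_rewind_marks]) (auto simp: N_def)
  have 4: "runs (rewind 3) (?T 0 N) (2 * N + 5) (?T 0 0)"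
    by (rule back_subst[of "runs _ _ _", OF runs_rewind_marks]) (auto simp: N_def)
  have "N \<le> n" by (simp add: N_def)
  then have "N * (4 * ?len + 9) \<le> n * (4 * ?len + 9)" "N \<le> n"
    by (auto intro: mult_right_mono)
  then have "runs mark [a0, a1, (marks n 0, int 0), (marks n 0, int 0), (tape_contents bs, 0), a5, a6]
     ((n + 1) * (4 * ?len + 20)) (?T 0 0)"
    unfolding mark_def
    by (intro runs_mono[OF runs_Seq[OF 1 runs_Seq[OF 2 runs_Seq[OF 3 4]]]])
      (simp add: algebra_simps)
  moreover have "read_tape (?a4 N) = 2 \<longleftrightarrow> n < val bs"
    using read[of N] by (auto simp: N_def)
  ultimately show ?thesis
    unfolding N_def marks_min by (intro exI[of _ "?a4 (min n (val bs))"]) simp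
qed

section \<open>Choosing between deleting and adding edges\<close>

text \<open>The unary prefix of the input serves as a counter with upper limit \<open>n\<close>: its head stops at the
  separator, and it reads a 2 in the end iff \<open>(k - 1)\<^sup>2 < n\<close>.\<close>

definition square_test :: com where
  "square_test =
     shift 2 R ;;
     Loop (\<lambda>s. s ! 2 = 2)
       (shift 3 R ;;
        Loop (\<lambda>s. s ! 3 = 2)
          (Act (\<lambda>s. (idle s)[0 := (s ! 0, if s ! 0 = 2 then R else Stay), 3 := (s ! 3, R)])) ;;
        rewind 3 ;; shift 2 R) ;;
     rewind 2"

text \<open>The symbol 1 at the origin of tape 5 lets the head find its way back, and it excludes loops.\<close>

definition stride :: "move \<Rightarrow> move \<Rightarrow> com" where
  "stride d e =
     Loop (\<lambda>s. s ! 3 \<noteq> 0)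
       (shift 2 R ;;
        Loop (\<lambda>s. s ! 2 = 2) (Act (\<lambda>s. (idle s)[2 := (s ! 2, R), 5 := (s ! 5, d)])) ;;
        Act (\<lambda>s. (idle s)[5 := (2, Stay)]) ;; rewind 2 ;; shift 3 R) ;;
     rewind 3 ;;
     Loop (\<lambda>s. s ! 5 \<noteq> 1) (shift 5 e)"

definition set_flag :: com where
  "set_flag = Act (\<lambda>s. (idle s)[6 := (2, Stay)])"

text \<open>For \<open>n < k\<close> nothing is written: distinct vertices are never congruent
  modulo \<open>k - 1 \<ge> n\<close>, so there is no edge to add. Otherwise a first cell other than
  2 means \<open>k = 0\<close>, which is settled before \<open>square_test\<close>, as the latter
  starts by skipping one mark.\<close>

definition choose_mode :: com where
  "choose_mode =
     Cond (\<lambda>s. s ! 4 = 2) (Act idle)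
       (Cond (\<lambda>s. s ! 2 \<noteq> 2) set_flag
         (square_test ;;
          Cond (\<lambda>s. s ! 0 = 2) set_flag
            (Act (\<lambda>s. (idle s)[5 := (1, Stay)]) ;; stride R L ;; stride L R) ;;
          rewind 0))"

lemma wf_choose_mode: "wf_com 7 choose_mode"
  by (auto simp: choose_mode_def square_test_def stride_def set_flag_def
      intro!: wf_shift wf_rewind acts_ok_update acts_ok_copy acts_ok_idle dest!: nth_mem)

text \<open>Both loops start at cell 1 and so meet \<open>m\<close> of the \<open>Suc m\<close>
  marks. Head 0 advances once per inner round and sticks at the separator, which amounts to counting
  to \<open>m * m\<close> with saturation at \<open>n\<close>.\<close>

lemma runs_square_test:
  assumes "Suc m \<le> n" "n < length x" "\<And>i. i < n \<Longrightarrow> x ! i" "\<not> x ! n"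
  shows "runs square_test
    [(tape_contents x, 0), a1, (marks n (Suc m), 0), (marks n (Suc m), 0), a4, a5, a6]
    (20 * (n + 1) * (n + 1))
    [(tape_contents x, int (min n (m * m))), a1, (marks n (Suc m), 0), (marks n (Suc m), 0), a4, a5, a6]"
proof -
  let ?S = "\<lambda>c p q. [(tape_contents x, int (min n c)), a1, (marks n (Suc m), int p),
    (marks n (Suc m), int q), a4, a5, a6]"
  let ?inner = "Loop (\<lambda>s. s ! 3 = 2)
    (Act (\<lambda>s. (idle s)[0 := (s ! 0, if s ! 0 = 2 then R else Stay), 3 := (s ! 3, R)]))"
  have 1: "runs (shift 2 R) (?S (0 * m) 0 0) 1 (?S (0 * m) (Suc 0) 0)"
    by (rule back_subst[of "runs _ _ _", OF runs_shift]) auto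
  have 2: "runs (Loop (\<lambda>s. s ! 2 = 2) (shift 3 R ;; ?inner ;; rewind 3 ;; shift 2 R))
    (?S (0 * m) (Suc 0) 0) (m * ((1 + (m * (1 + 1) + 1 + (2 * Suc m + 5 + 1 + 1) + 1) + 1) + 1) + 1)
    (?S (m * m) (Suc m) 0)"
  proof (rule runs_Loop[where S = "\<lambda>i. ?S (i * m) (Suc i) 0"])
    fix i assume i: "i < m"
    show "map read_tape (?S (i * m) (Suc i) 0) ! 2 = 2"
      using i assms(1) by (simp add: read_tape_def marks_nth del: of_nat_Suc)
    have "runs (shift 3 R) (?S (i * m) (Suc i) 0) 1 (?S (i * m + 0) (Suc i) (Suc 0))"
      by (rule back_subst[of "runs _ _ _", OF runs_shift]) auto
    moreover have "runs ?inner (?S (i * m + 0) (Suc i) (Suc 0)) (m * (1 + 1) + 1)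
      (?S (i * m + m) (Suc i) (Suc m))"
    proof (rule runs_Loop[where S = "\<lambda>j. ?S (i * m + j) (Suc i) (Suc j)"])
      fix j assume j: "j < m"
      show "map read_tape (?S (i * m + j) (Suc i) (Suc j)) ! 3 = 2"
        using j assms(1) by (simp add: read_tape_def marks_nth del: of_nat_Suc)
      have rd: "tape_contents x (int (min n c)) = 2 \<longleftrightarrow> c < n" for c
        using assms by (cases "c < n") (auto simp: contents_nth min_def)
      show "runs (Act (\<lambda>s. (idle s)[0 := (s ! 0, if s ! 0 = 2 then R else Stay), 3 := (s ! 3, R)]))
        (?S (i * m + j) (Suc i) (Suc j)) 1 (?S (i * m + Suc j) (Suc i) (Suc (Suc j)))"
        by (rule runs_ActI)
          (auto simp add: act_tape_def read_tape_def idle_def rd simp del: of_nat_min)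
    next
      show "map read_tape (?S (i * m + m) (Suc i) (Suc m)) ! 3 \<noteq> 2"
        by (simp add: read_tape_def marks_nth del: of_nat_Suc)
    qed
    moreover have "runs (rewind 3) (?S (i * m + m) (Suc i) (Suc m)) (2 * Suc m + 5)
      (?S (i * m + m) (Suc i) 0)"
      by (rule back_subst[of "runs _ _ _", OF runs_rewind_marks]) (use assms in auto)
    moreover have "runs (shift 2 R) (?S (i * m + m) (Suc i) 0) 1 (?S (Suc i * m) (Suc (Suc i)) 0)"
      by (rule back_subst[of "runs _ _ _", OF runs_shift]) (auto simp: add.commute)
    ultimately show "runs (shift 3 R ;; ?inner ;; rewind 3 ;; shift 2 R) (?S (i * m) (Suc i) 0)
       (1 + (m * (1 + 1) + 1 + (2 * Suc m + 5 + 1 + 1) + 1) + 1) (?S (Suc i * m) (Suc (Suc i)) 0)"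
      by (intro runs_Seq)
  next
    show "map read_tape (?S (m * m) (Suc m) 0) ! 2 \<noteq> 2"
      by (simp add: read_tape_def marks_nth del: of_nat_Suc)
  qed
  have 3: "runs (rewind 2) (?S (m * m) (Suc m) 0) (2 * Suc m + 5) (?S (m * m) 0 0)"
    by (rule back_subst[of "runs _ _ _", OF runs_rewind_marks]) (use assms in auto)
  have "m * m \<le> n * n" "m \<le> n" using assms(1) by (auto intro: mult_le_mono)
  then have "runs square_test (?S (0 * m) 0 0) (20 * (n + 1) * (n + 1)) (?S (m * m) 0 0)"
    unfolding square_test_def
    by (intro runs_mono[OF runs_Seq[OF 1 runs_Seq[OF 2 3]]]) (simp add: algebra_simps)
  then show ?thesis by simp
qed

text \<open>The sign \<open>sg\<close> lets one statement serve both directions. Since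
  \<open>1 \<le> m\<close>, the strides never overwrite the 1 at the origin, and as no other cell
  holds a 1, the way back ends exactly there.\<close>

lemma runs_stride:
  fixes F :: "int \<Rightarrow> nat" and sg :: int
  assumes "Suc m \<le> n" "1 \<le> m" and F: "F 0 = 1" "\<And>p. p \<noteq> 0 \<Longrightarrow> F p \<noteq> 1"
    and sg: "sg = 1 \<or> sg = - 1" "\<And>h. move_head d h = h + sg" "\<And>h. move_head e h = h - sg"
  shows "runs (stride d e)
    [a0, a1, (marks n (Suc m), 0), (marks n (Suc m), 0), a4, (F, 0), a6]
    (20 * (n + 1) * (n + 1))
    [a0, a1, (marks n (Suc m), 0), (marks n (Suc m), 0), a4,
      (\<lambda>p. if \<exists>i\<in>{1..n}. p = sg * int (m * i) then 2 else F p, 0), a6]"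
proof -
  let ?F = "\<lambda>i p. if \<exists>i\<in>{1..i}. p = sg * int (m * i) then 2 else F p"
  let ?S = "\<lambda>p q i c. [a0, a1, (marks n (Suc m), int p), (marks n (Suc m), int q), a4,
    (?F i, sg * int c), a6]"
  let ?inner = "Loop (\<lambda>s. s ! 2 = 2) (Act (\<lambda>s. (idle s)[2 := (s ! 2, R), 5 := (s ! 5, d)]))"
  have 1: "runs (Loop (\<lambda>s. s ! 3 \<noteq> 0)
       (shift 2 R ;; ?inner ;; Act (\<lambda>s. (idle s)[5 := (2, Stay)]) ;; rewind 2 ;; shift 3 R))
     (?S 0 0 0 (m * 0))
     (n * ((1 + (m * (1 + 1) + 1 + (1 + (2 * Suc m + 5 + 1 + 1) + 1) + 1) + 1) + 1) + 1)
     (?S 0 n n (m * n))"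
  proof (rule runs_Loop[where S = "\<lambda>i. ?S 0 i i (m * i)"])
    fix i assume i: "i < n"
    show "map read_tape (?S 0 i i (m * i)) ! 3 \<noteq> 0"
      using i by (simp add: read_tape_def marks_nth)
    have "runs (shift 2 R) (?S 0 i i (m * i)) 1 (?S (Suc 0) i i (m * i + 0))"
      by (rule back_subst[of "runs _ _ _", OF runs_shift]) auto
    moreover have "runs ?inner (?S (Suc 0) i i (m * i + 0)) (m * (1 + 1) + 1)
      (?S (Suc m) i i (m * i + m))"
    proof (rule runs_Loop[where S = "\<lambda>j. ?S (Suc j) i i (m * i + j)"])
      fix j assume j: "j < m"
      show "map read_tape (?S (Suc j) i i (m * i + j)) ! 2 = 2"
        using j assms(1) by (simp add: read_tape_def marks_nth del: of_nat_Suc)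
      show "runs (Act (\<lambda>s. (idle s)[2 := (s ! 2, R), 5 := (s ! 5, d)]))
        (?S (Suc j) i i (m * i + j)) 1 (?S (Suc (Suc j)) i i (m * i + Suc j))"
        by (rule runs_ActI)
          (simp add: act_tape_def read_tape_def idle_def sg(2) algebra_simps fun_upd_idem)
    next
      show "map read_tape (?S (Suc m) i i (m * i + m)) ! 2 \<noteq> 2"
        by (simp add: read_tape_def marks_nth del: of_nat_Suc)
    qed
    moreover have "runs (Act (\<lambda>s. (idle s)[5 := (2, Stay)])) (?S (Suc m) i i (m * i + m)) 1
       (?S (Suc m) i (Suc i) (m * Suc i))"
    proof -
      define q where "q = m * Suc i"
      have upd: "(?F i)(sg * int q := 2) = ?F (Suc i)"
        by (rule ext) (auto simp: atLeastAtMostSuc_conv q_def algebra_simps)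
      have "runs (Act (\<lambda>s. (idle s)[5 := (2, Stay)])) (?S (Suc m) i i q) 1 (?S (Suc m) i (Suc i) q)"
        using upd by (intro runs_ActI) (simp add: act_tape_def read_tape_def idle_def)
      then show ?thesis by (simp add: q_def add.commute)
    qed
    moreover have "runs (rewind 2) (?S (Suc m) i (Suc i) (m * Suc i)) (2 * Suc m + 5)
      (?S 0 i (Suc i) (m * Suc i))"
      by (rule back_subst[of "runs _ _ _", OF runs_rewind_marks]) (use assms in auto)
    moreover have "runs (shift 3 R) (?S 0 i (Suc i) (m * Suc i)) 1 (?S 0 (Suc i) (Suc i) (m * Suc i))"
      by (rule back_subst[of "runs _ _ _", OF runs_shift]) auto
    ultimately show "runs
       (shift 2 R ;; ?inner ;; Act (\<lambda>s. (idle s)[5 := (2, Stay)]) ;; rewind 2 ;; shift 3 R)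
       (?S 0 i i (m * i))
       (1 + (m * (1 + 1) + 1 + (1 + (2 * Suc m + 5 + 1 + 1) + 1) + 1) + 1)
       (?S 0 (Suc i) (Suc i) (m * Suc i))"
      by (intro runs_Seq)
  next
    show "\<not> map read_tape (?S 0 n n (m * n)) ! 3 \<noteq> 0"
      by (simp add: read_tape_def marks_nth)
  qed
  have 2: "runs (rewind 3) (?S 0 n n (m * n)) (2 * n + 5) (?S 0 0 n (m * n - 0))"
    by (rule back_subst[of "runs _ _ _", OF runs_rewind_marks]) auto
  have 3: "runs (Loop (\<lambda>s. s ! 5 \<noteq> 1) (shift 5 e)) (?S 0 0 n (m * n - 0)) (m * n * (1 + 1) + 1)
    (?S 0 0 n (m * n - m * n))"
  proof (rule runs_Loop[where S = "\<lambda>j. ?S 0 0 n (m * n - j)"])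
    fix j assume j: "j < m * n"
    have "sg * int (m * n - j) \<noteq> 0" using j sg(1) by (auto simp del: of_nat_diff)
    from F(2)[OF this] show "map read_tape (?S 0 0 n (m * n - j)) ! 5 \<noteq> 1"
      by (simp add: read_tape_def del: of_nat_diff)
    show "runs (shift 5 e) (?S 0 0 n (m * n - j)) 1 (?S 0 0 n (m * n - Suc j))"
      by (rule back_subst[of "runs _ _ _", OF runs_shift])
        (use j in \<open>auto simp: sg(3) of_nat_diff algebra_simps\<close>)
  next
    show "\<not> map read_tape (?S 0 0 n (m * n - m * n)) ! 5 \<noteq> 1"
      using assms(2) F(1) sg(1) by (auto simp: read_tape_def)
  qed
  have le: "m * n \<le> n * n" "m \<le> n" using assms(1) by (auto intro: mult_le_mono)
  have "runs (stride d e) (?S 0 0 0 (m * 0)) (20 * (n + 1) * (n + 1)) (?S 0 0 n (m * n - m * n))"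
    unfolding stride_def
    by (intro runs_mono[OF runs_Seq[OF 1 runs_Seq[OF 2 3]]], simp add: algebra_simps)
      (use le in linarith)
  then show ?thesis by simp
qed

text \<open>Truncated subtraction makes the square 0 at \<open>k = 0\<close>; the disjunct
  \<open>k = 0\<close> settles the graph without vertices, for which \<open>0 < n\<close>
  fails.\<close>

definition few :: "nat \<Rightarrow> nat \<Rightarrow> bool" where
  "few n k \<longleftrightarrow> k \<le> n \<and> (k = 0 \<or> (k - 1) * (k - 1) < n)"

text \<open>Tape 5 is described only for \<open>\<bar>p\<bar> < int n\<close>, since the entries
  that decide about edges sit at differences of two vertices. Position 0 stands for the diagonal of
  the matrix and must not ask for an edge.\<close>

lemma runs_choose_mode:
  assumes "n < length x" "\<And>i. i < n \<Longrightarrow> x ! i" "\<not> x ! n" "read_tape a4 = 2 \<longleftrightarrow> n < k"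
  shows "\<exists>F a6. runs choose_mode
    [(tape_contents x, 0), a1, (marks n k, 0), (marks n k, 0), a4,
     (tape_contents [], 0), (tape_contents [], 0)]
    (100 * (n + 1) * (n + 1))
    [(tape_contents x, 0), a1, (marks n k, 0), (marks n k, 0), a4, (F, 0), a6] \<and>
    (read_tape a6 = 2 \<longleftrightarrow> few n k) \<and>
    (\<not> few n k \<longrightarrow> (\<forall>p. \<bar>p\<bar> < int n \<longrightarrow> (F p = 2 \<longleftrightarrow> p \<noteq> 0 \<and> int (k - 1) dvd p)))"
proof -
  have nil: "tape_contents [] = (\<lambda>_. 0)" by (rule ext) (simp add: tape_contents_def)
  let ?S = "\<lambda>c a5 a6. [(tape_contents x, int c), a1, (marks n k, 0), (marks n k, 0), a4, a5, a6]"
  let ?b = "(\<lambda>_. 0, 0) :: tape"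
  let ?f = "((\<lambda>_. 0)(0 := 2), 0) :: tape"
  have flag: "runs set_flag (?S c a5 ?b) 1 (?S c a5 ?f)" for c a5
    unfolding set_flag_def by (rule runs_ActI) (simp add: act_tape_def read_tape_def idle_def)
  have read_b: "read_tape ?b = 0" and read_f: "read_tape ?f = 2"
    by (simp_all add: read_tape_def)
  consider "n < k" | "k \<le> n" "k = 0" | "k \<le> n" "0 < k" by linarith
  then show ?thesis
  proof cases
    case 1
    have "runs choose_mode (?S 0 ?b ?b) (1 + 1) (?S 0 ?b ?b)"
      unfolding choose_mode_def
    proof (rule runs_Cond)
      show "runs (Act idle) (?S 0 ?b ?b) 1 (?S 0 ?b ?b)"
        by (rule runs_ActI) (rule act_idle)
    qed (use 1 assms in auto)
    then have "runs choose_mode (?S 0 ?b ?b) (100 * (n + 1) * (n + 1)) (?S 0 ?b ?b)"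
      by (rule runs_mono) simp
    \<comment> \<open>The blank tape 5 is correct here, because every nonzero multiple of
      \<open>k - 1 \<ge> n\<close> lies outside the range.\<close>
    moreover have "\<not> int (k - 1) dvd p" if "p \<noteq> 0" "\<bar>p\<bar> < int n" for p
      using that 1 zdvd_imp_le[of "int (k - 1)" "\<bar>p\<bar>"] by auto
    moreover have "\<not> few n k" using 1 by (simp add: few_def)
    ultimately show ?thesis
      using read_b by (intro exI[of _ "\<lambda>_. 0"] exI[of _ ?b]) (auto simp: nil)
  next
    case 2
    have "runs choose_mode (?S 0 ?b ?b) (1 + 1 + 1) (?S 0 ?b ?f)"
      unfolding choose_mode_def
      apply (rule runs_Cond)
      subgoal using 2 assms by auto
      subgoal
        apply (rule runs_Cond)
        subgoal using flag[of 0 ?b] by simp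
        subgoal using 2 marks_nth[of n 0 0] by (simp add: read_tape_def split: if_splits)
        done
      done
    then have "runs choose_mode (?S 0 ?b ?b) (100 * (n + 1) * (n + 1)) (?S 0 ?b ?f)"
      by (rule runs_mono) simp
    moreover have "few n k" using 2 by (simp add: few_def)
    ultimately show ?thesis
      using read_f by (intro exI[of _ "\<lambda>_. 0"] exI[of _ ?f]) (auto simp: nil)
  next
    case 3
    then obtain m where m: "k = Suc m" by (cases k) auto
    let ?c = "min n (m * m)"
    have sq: "runs square_test (?S 0 ?b ?b) (20 * (n + 1) * (n + 1)) (?S ?c ?b ?b)"
      using runs_square_test[of m n x] assms 3 m by simp
    have rew: "runs (rewind 0) (?S ?c a5 a6) (2 * n + 5) (?S 0 a5 a6)" for a5 a6
      by (rule runs_mono, rule back_subst[of "runs _ _ _", OF runs_rewind])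
        (use assms(1) in auto)
    have rd: "tape_contents x (int ?c) = 2 \<longleftrightarrow> few n k"
      using assms(1-3) 3 m contents_nth[of x ?c]
      by (cases "m * m < n") (auto simp: few_def min_def)
    have tapes: "\<exists>F a6. runs (Cond (\<lambda>s. s ! 0 = 2) set_flag
            (Act (\<lambda>s. (idle s)[5 := (1, Stay)]) ;; stride R L ;; stride L R))
        (?S ?c ?b ?b) (42 * (n + 1) * (n + 1)) (?S ?c (F, 0) a6) \<and>
      (read_tape a6 = 2 \<longleftrightarrow> few n k) \<and>
      (\<not> few n k \<longrightarrow> (\<forall>p. \<bar>p\<bar> < int n \<longrightarrow> (F p = 2 \<longleftrightarrow> p \<noteq> 0 \<and> int (k - 1) dvd p)))"
    proof (cases "few n k")
      case True
      have "runs (Cond (\<lambda>s. s ! 0 = 2) set_flag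
            (Act (\<lambda>s. (idle s)[5 := (1, Stay)]) ;; stride R L ;; stride L R))
        (?S ?c ?b ?b) (1 + 1) (?S ?c ?b ?f)"
        by (rule runs_Cond) (use True rd flag in \<open>auto simp: read_tape_def\<close>)
      then have "runs (Cond (\<lambda>s. s ! 0 = 2) set_flag
            (Act (\<lambda>s. (idle s)[5 := (1, Stay)]) ;; stride R L ;; stride L R))
        (?S ?c ?b ?b) (42 * (n + 1) * (n + 1)) (?S ?c ?b ?f)"
        by (rule runs_mono) simp
      then show ?thesis using True read_f by blast
    next
      case False
      \<comment> \<open>For \<open>m = 0\<close>, that is \<open>k = 1\<close>, the assumption
        \<open>k \<le> n\<close> would make \<open>few\<close> true.\<close>
      then have m1: "1 \<le> m" using 3 m by (cases m) (auto simp: few_def)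
      let ?F0 = "(\<lambda>_. 0 :: nat)(0 :: int := 1)"
      let ?F1 = "\<lambda>p. if \<exists>i\<in>{1..n}. p = 1 * int (m * i) then 2 else ?F0 p"
      let ?F2 = "\<lambda>p. if \<exists>i\<in>{1..n}. p = - 1 * int (m * i) then 2 else ?F1 p"
      have w: "runs (Act (\<lambda>s. (idle s)[5 := (1, Stay)])) (?S ?c ?b ?b) 1 (?S ?c (?F0, 0) ?b)"
        by (rule runs_ActI) (simp add: act_tape_def read_tape_def idle_def fun_upd_idem)
      have r: "runs (stride R L) (?S ?c (?F0, 0) ?b) (20 * (n + 1) * (n + 1)) (?S ?c (?F1, 0) ?b)"
        unfolding m by (rule runs_stride) (use 3 m m1 in auto)
      have l: "runs (stride L R) (?S ?c (?F1, 0) ?b) (20 * (n + 1) * (n + 1)) (?S ?c (?F2, 0) ?b)"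
        unfolding m by (rule runs_stride) (use 3 m m1 in auto)
      have "runs (Cond (\<lambda>s. s ! 0 = 2) set_flag
            (Act (\<lambda>s. (idle s)[5 := (1, Stay)]) ;; stride R L ;; stride L R))
        (?S ?c ?b ?b) (1 + (20 * (n + 1) * (n + 1) + 20 * (n + 1) * (n + 1) + 1) + 1 + 1) (?S ?c (?F2, 0) ?b)"
      proof (rule runs_Cond)
        show "runs (Act (\<lambda>s. (idle s)[5 := (1, Stay)]) ;; stride R L ;; stride L R) (?S ?c ?b ?b)
          (1 + (20 * (n + 1) * (n + 1) + 20 * (n + 1) * (n + 1) + 1) + 1) (?S ?c (?F2, 0) ?b)"
          by (rule runs_Seq[OF w runs_Seq[OF r l]])
      qed (use False rd in \<open>auto simp: read_tape_def\<close>)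
      then have "runs (Cond (\<lambda>s. s ! 0 = 2) set_flag
            (Act (\<lambda>s. (idle s)[5 := (1, Stay)]) ;; stride R L ;; stride L R))
        (?S ?c ?b ?b) (42 * (n + 1) * (n + 1)) (?S ?c (?F2, 0) ?b)"
        using 3 by (rule_tac runs_mono) (auto simp: algebra_simps)
      moreover have "?F2 p = 2 \<longleftrightarrow> p \<noteq> 0 \<and> int (k - 1) dvd p" if p: "\<bar>p\<bar> < int n" for p
      proof -
        have "?F2 p = 2 \<longleftrightarrow> (\<exists>i\<in>{1..n}. \<bar>p\<bar> = int (m * i))"
        proof -
          have eq: "\<bar>p\<bar> = int (m * i) \<longleftrightarrow> p = 1 * int (m * i) \<or> p = - 1 * int (m * i)" for i
            by auto
          show ?thesis unfolding eq by auto
        qed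
        also have "\<dots> \<longleftrightarrow> p \<noteq> 0 \<and> int m dvd p"
        proof
          assume "p \<noteq> 0 \<and> int m dvd p"
          then obtain q where q: "\<bar>p\<bar> = int m * q" "p \<noteq> 0"
            by (metis dvd_abs_iff dvdE)
          then have "0 < q" using m1
            by (metis abs_ge_zero abs_eq_0 linorder_not_less mult_nonneg_nonpos of_nat_0_le_iff order_antisym)
          \<comment> \<open>The cofactor is at most \<open>\<bar>p\<bar>\<close>, so
            \<open>n\<close> strides in each direction miss no multiple in the range.\<close>
          moreover have "q < int n"
          proof -
            have "1 * q \<le> int m * q"
              using m1 \<open>0 < q\<close> by (intro mult_right_mono) auto
            then show ?thesis using q p by linarith
          qed
          ultimately have "nat q \<in> {1..n}" "\<bar>p\<bar> = int (m * nat q)"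
            using q p by auto
          then show "\<exists>i\<in>{1..n}. \<bar>p\<bar> = int (m * i)" by blast
        next
          assume "\<exists>i\<in>{1..n}. \<bar>p\<bar> = int (m * i)"
          then show "p \<noteq> 0 \<and> int m dvd p"
            using m1 by (metis abs_0 atLeastAtMost_iff dvd_abs_iff dvd_triv_left mult_eq_0_iff
                not_one_le_zero of_nat_eq_0_iff of_nat_mult)
        qed
        finally show ?thesis using m by simp
      qed
      ultimately show ?thesis using False read_b
        by (intro exI[of _ ?F2] exI[of _ ?b]) auto
    qed
    then obtain F a6 where F: "runs (Cond (\<lambda>s. s ! 0 = 2) set_flag
            (Act (\<lambda>s. (idle s)[5 := (1, Stay)]) ;; stride R L ;; stride L R))
        (?S ?c ?b ?b) (42 * (n + 1) * (n + 1)) (?S ?c (F, 0) a6)"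
      and spec: "read_tape a6 = 2 \<longleftrightarrow> few n k"
        "\<not> few n k \<longrightarrow> (\<forall>p. \<bar>p\<bar> < int n \<longrightarrow> (F p = 2 \<longleftrightarrow> p \<noteq> 0 \<and> int (k - 1) dvd p))"
      by blast
    have "runs choose_mode (?S 0 ?b ?b)
        (20 * (n + 1) * (n + 1) + (42 * (n + 1) * (n + 1) + (2 * n + 5) + 1) + 1 + 1 + 1)
        (?S 0 (F, 0) a6)"
      unfolding choose_mode_def
      apply (rule runs_Cond)
      subgoal using 3 assms by auto
      subgoal
        apply (rule runs_Cond)
        subgoal using 3 marks_nth[of n k 0] by (simp add: read_tape_def)
        subgoal by (rule runs_Seq[OF sq runs_Seq[OF F rew]])
        done
      done
    then have "runs choose_mode (?S 0 ?b ?b) (100 * (n + 1) * (n + 1)) (?S 0 (F, 0) a6)"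
      by (rule runs_mono) (simp add: algebra_simps)
    with spec show ?thesis unfolding nil of_nat_0 by blast
  qed
qed

section \<open>Writing the output\<close>

definition new_symbol :: "nat list \<Rightarrow> nat" where
  "new_symbol s =
     (if s ! 6 = 2 then (if s ! 2 = 2 \<and> s ! 3 = 2 then 1 else s ! 0)
      else (if s ! 5 = 2 then 2 else s ! 0))"

text \<open>Tape 5 may have blanks between its entries, so \<open>rewind\<close> cannot be used on
  it. Its head goes back in step with head 3 instead, and one further move to the left puts it at
  the start \<open>- Suc i\<close> of the next row.\<close>

definition emit_row :: com where
  "emit_row =
     Loop (\<lambda>s. s ! 3 \<noteq> 0)
       (Act (\<lambda>s. (idle s)[0 := (s ! 0, R), 1 := (new_symbol s, R), 3 := (s ! 3, R), 5 := (s ! 5, R)])) ;;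
     shift 3 L ;;
     Loop (\<lambda>s. s ! 3 \<noteq> 0) (Act (\<lambda>s. (idle s)[3 := (s ! 3, L), 5 := (s ! 5, L)])) ;;
     Act (\<lambda>s. (idle s)[2 := (s ! 2, R), 3 := (s ! 3, R), 5 := (s ! 5, L)])"

definition emit_tail :: com where
  "emit_tail =
     Cond (\<lambda>s. s ! 6 = 2)
       (Act (\<lambda>s. (idle s)[1 := (2, R)]) ;;
        Loop (\<lambda>s. s ! 2 \<noteq> 0) (Act (\<lambda>s. (idle s)[1 := (s ! 2, R), 2 := (s ! 2, R)])))
       (Act (\<lambda>s. (idle s)[1 := (1, R)]))"

text \<open>The unary prefix and the encoded \<open>k\<close> are copied verbatim, as a finite
  distance demands the same vertices and the same \<open>k\<close>; only matrix bits may
  change.\<close>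

definition emit :: com where
  "emit =
     Loop (\<lambda>s. s ! 0 = 2) (Act (\<lambda>s. (idle s)[0 := (s ! 0, R), 1 := (s ! 0, R)])) ;;
     Act (\<lambda>s. (idle s)[0 := (s ! 0, R), 1 := (1, R)]) ;;
     Loop (\<lambda>s. s ! 2 \<noteq> 0) emit_row ;;
     rewind 2 ;;
     Loop (\<lambda>s. s ! 0 \<noteq> 0) (Act (\<lambda>s. (idle s)[0 := (s ! 0, R), 1 := (s ! 0, R)])) ;;
     emit_tail"

lemma wf_emit: "wf_com 7 emit"
  by (auto simp: emit_def emit_row_def emit_tail_def new_symbol_def
      intro!: wf_shift wf_rewind acts_ok_update acts_ok_copy acts_ok_idle dest!: nth_mem)

definition out :: "bool list \<Rightarrow> tape" where
  "out w = (tape_contents w, int (length w))"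

lemma act_tape_out: "act_tape (if b then 2 else Suc 0, R) (out w) = out (w @ [b])"
  using contents_snoc[of w b] by (cases b) (simp_all add: act_tape_def out_def)

lemma act_tape_out_const:
  "act_tape (2, R) (out w) = out (w @ [True])" "act_tape (Suc 0, R) (out w) = out (w @ [False])"
  using act_tape_out[of True w] act_tape_out[of False w] by simp_all

lemma act_tape_stay: "act_tape (read_tape t, Stay) t = t"
  by (simp add: act_tape_def read_tape_def)

lemma act_tape_pair: "act_tape (v, d) (f, h) = (f(h := v), move_head d h)"
  by (simp add: act_tape_def)

lemma read_tape_pair: "read_tape (f, h) = f h"
  by (simp add: read_tape_def)

lemmas act_simps = act_tape_stay act_tape_pair read_tape_pair idle_def

context input_string
begin

definition new_bit :: "bool \<Rightarrow> nat \<Rightarrow> (int \<Rightarrow> nat) \<Rightarrow> nat \<Rightarrow> nat \<Rightarrow> bool" where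
  "new_bit flag k F i j =
     (if flag then x ! (Suc n + i * n + j) \<and> \<not> (i < k \<and> j < k)
      else x ! (Suc n + i * n + j) \<or> F (int j - int i) = 2)"

definition new_rows :: "bool \<Rightarrow> nat \<Rightarrow> (int \<Rightarrow> nat) \<Rightarrow> nat \<Rightarrow> bool list" where
  "new_rows flag k F i = concat (map (\<lambda>i. map (new_bit flag k F i) [0..<n]) [0..<i])"

lemma contents_x: "p < length x \<Longrightarrow> tape_contents x (int p) = (if x ! p then 2 else Suc 0)"
  by (simp add: contents_nth)

text \<open>The stopping test \<open>P\<close> is kept general: the unary prefix is copied up to the
  first symbol other than 2, the encoded number up to the blank.\<close>

lemma runs_copy:
  assumes "p + c \<le> length x"
    and "\<And>i. i < c \<Longrightarrow> P (tape_contents x (int (p + i)))"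
    and "\<not> P (tape_contents x (int (p + c)))"
  shows "runs (Loop (\<lambda>s. P (s ! 0)) (Act (\<lambda>s. (idle s)[0 := (s ! 0, R), 1 := (s ! 0, R)])))
    [(tape_contents x, int p), out w, a2, a3, a4, a5, a6] (c * (1 + 1) + 1)
    [(tape_contents x, int (p + c)), out (w @ take c (drop p x)), a2, a3, a4, a5, a6]"
proof -
  let ?S = "\<lambda>i. [(tape_contents x, int (p + i)), out (w @ take i (drop p x)), a2, a3, a4, a5, a6]"
  have "runs (Loop (\<lambda>s. P (s ! 0)) (Act (\<lambda>s. (idle s)[0 := (s ! 0, R), 1 := (s ! 0, R)])))
    (?S 0) (c * (1 + 1) + 1) (?S c)"
  proof (rule runs_Loop)
    fix i assume i: "i < c"
    show "P (map read_tape (?S i) ! 0)"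
      using assms(2)[OF i] by (simp add: read_tape_pair)
    have snoc: "act_tape (tape_contents x (int (p + i)), R) (out (w @ take i (drop p x))) =
        out (w @ take (Suc i) (drop p x))"
      using i assms(1) by (subst contents_x) (auto simp: act_tape_out_const take_Suc_conv_app_nth)
    show "runs (Act (\<lambda>s. (idle s)[0 := (s ! 0, R), 1 := (s ! 0, R)])) (?S i) 1 (?S (Suc i))"
      using snoc by (intro runs_ActI) (simp add: act_simps)
  qed (use assms(3) in \<open>simp add: read_tape_pair\<close>)
  then show ?thesis by simp
qed

lemma runs_emit_row:
  assumes i: "i < n" and flag: "read_tape a6 = 2 \<longleftrightarrow> flag"
  shows "runs emit_row
    [(tape_contents x, int (Suc n + i * n)), out w, (marks n k, int i), (marks n k, 0), a4, (F, - int i), a6]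
    (4 * n + 10)
    [(tape_contents x, int (Suc n + Suc i * n)), out (w @ map (new_bit flag k F i) [0..<n]),
     (marks n k, int (Suc i)), (marks n k, 0), a4, (F, - int (Suc i)), a6]"
proof -
  let ?S = "\<lambda>j. [(tape_contents x, int (Suc n + i * n + j)), out (w @ map (new_bit flag k F i) [0..<j]),
    (marks n k, int i), (marks n k, int j), a4, (F, int j - int i), a6]"
  have 1: "runs (Loop (\<lambda>s. s ! 3 \<noteq> 0)
       (Act (\<lambda>s. (idle s)[0 := (s ! 0, R), 1 := (new_symbol s, R), 3 := (s ! 3, R), 5 := (s ! 5, R)])))
     (?S 0) (n * (1 + 1) + 1) (?S n)"
  proof (rule runs_Loop)
    fix j assume j: "j < n"
    show "map read_tape (?S j) ! 3 \<noteq> 0"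
      using j by (simp add: read_tape_pair marks_nth)
    have "Suc i * n \<le> n * n" using i by (intro mult_right_mono) auto
    then have "Suc n + i * n + j < length x"
      using j by (simp add: length_x m_eq)
    from contents_x[OF this]
    have "new_symbol (map read_tape (?S j)) = (if new_bit flag k F i j then 2 else Suc 0)"
      using i j flag
      by (simp add: new_symbol_def new_bit_def read_tape_pair marks_nth del: of_nat_add of_nat_Suc)
    then have snoc: "act_tape (new_symbol (map read_tape (?S j)), R) (out (w @ map (new_bit flag k F i) [0..<j])) =
        out (w @ map (new_bit flag k F i) [0..<Suc j])"
      by (simp add: act_tape_out_const)
    then show "runs (Act (\<lambda>s. (idle s)
        [0 := (s ! 0, R), 1 := (new_symbol s, R), 3 := (s ! 3, R), 5 := (s ! 5, R)])) (?S j) 1 (?S (Suc j))"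
      by (intro runs_ActI) (simp add: act_simps algebra_simps)
  next
    show "\<not> map read_tape (?S n) ! 3 \<noteq> 0"
      by (simp add: read_tape_pair marks_nth)
  qed
  let ?a0 = "(tape_contents x, int (Suc n + Suc i * n))"
  let ?out = "out (w @ map (new_bit flag k F i) [0..<n])"
  let ?T = "\<lambda>p q. [?a0, ?out, (marks n k, int i), (marks n k, p), a4, (F, q), a6]"
  have 2: "runs (shift 3 L) (?S n) 1 (?T (int n - 1 - int 0) (int n - int i - int 0))"
    by (rule back_subst[of "runs _ _ _", OF runs_shift]) auto
  have 3: "runs (Loop (\<lambda>s. s ! 3 \<noteq> 0) (Act (\<lambda>s. (idle s)[3 := (s ! 3, L), 5 := (s ! 5, L)])))
    (?T (int n - 1 - int 0) (int n - int i - int 0)) (n * (1 + 1) + 1)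
    (?T (int n - 1 - int n) (int n - int i - int n))"
  proof (rule runs_Loop[where S = "\<lambda>j. ?T (int n - 1 - int j) (int n - int i - int j)"])
    fix j assume j: "j < n"
    then have "int n - 1 - int j = int (n - 1 - j)" by simp
    then show "map read_tape (?T (int n - 1 - int j) (int n - int i - int j)) ! 3 \<noteq> 0"
      using j by (simp add: read_tape_pair marks_nth del: of_nat_diff)
    show "runs (Act (\<lambda>s. (idle s)[3 := (s ! 3, L), 5 := (s ! 5, L)]))
       (?T (int n - 1 - int j) (int n - int i - int j)) 1
       (?T (int n - 1 - int (Suc j)) (int n - int i - int (Suc j)))"
      by (intro runs_ActI) (simp add: act_simps algebra_simps)
  next
    show "\<not> map read_tape (?T (int n - 1 - int n) (int n - int i - int n)) ! 3 \<noteq> 0"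
      by (simp add: read_tape_pair marks_def tape_contents_def)
  qed
  have 4: "runs (Act (\<lambda>s. (idle s)[2 := (s ! 2, R), 3 := (s ! 3, R), 5 := (s ! 5, L)]))
    (?T (int n - 1 - int n) (int n - int i - int n)) 1
    [?a0, ?out, (marks n k, int (Suc i)), (marks n k, 0), a4, (F, - int (Suc i)), a6]"
    by (intro runs_ActI) (simp add: act_simps algebra_simps)
  have "runs emit_row (?S 0) (4 * n + 10)
    [?a0, ?out, (marks n k, int (Suc i)), (marks n k, 0), a4, (F, - int (Suc i)), a6]"
    unfolding emit_row_def
    by (rule runs_mono[OF runs_Seq[OF 1 runs_Seq[OF 2 runs_Seq[OF 3 4]]]]) simp
  then show ?thesis by simp
qed

lemma runs_emit_tail:
  assumes flag: "read_tape a6 = 2 \<longleftrightarrow> flag"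
  shows "\<exists>T. runs emit_tail [a0, out w, (marks n k, 0), a3, a4, a5, a6] (2 * n + 4) T \<and>
    T ! 1 = out (w @ (if flag then True # map (\<lambda>v. v < k) [0..<n] else [False]))"
proof -
  let ?S = "\<lambda>j. [a0, out (w @ True # map (\<lambda>v. v < k) [0..<j]), (marks n k, int j), a3, a4, a5, a6]"
  have 1: "runs (Act (\<lambda>s. (idle s)[1 := (2, R)])) [a0, out w, (marks n k, 0), a3, a4, a5, a6] 1 (?S 0)"
    by (intro runs_ActI) (simp add: act_simps act_tape_out_const)
  have 2: "runs (Loop (\<lambda>s. s ! 2 \<noteq> 0) (Act (\<lambda>s. (idle s)[1 := (s ! 2, R), 2 := (s ! 2, R)])))
    (?S 0) (n * (1 + 1) + 1) (?S n)"
  proof (rule runs_Loop)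
    fix j assume j: "j < n"
    show "map read_tape (?S j) ! 2 \<noteq> 0"
      using j by (simp add: read_tape_pair marks_nth)
    have "act_tape (marks n k (int j), R) (out (w @ True # map (\<lambda>v. v < k) [0..<j])) =
        out (w @ True # map (\<lambda>v. v < k) [0..<Suc j])"
      using j by (simp add: marks_nth act_tape_out_const)
    then show "runs (Act (\<lambda>s. (idle s)[1 := (s ! 2, R), 2 := (s ! 2, R)])) (?S j) 1 (?S (Suc j))"
      by (intro runs_ActI) (simp add: act_simps)
  next
    show "\<not> map read_tape (?S n) ! 2 \<noteq> 0"
      by (simp add: read_tape_pair marks_nth)
  qed
  have 3: "runs (Act (\<lambda>s. (idle s)[1 := (1, R)])) [a0, out w, (marks n k, 0), a3, a4, a5, a6] 1
    [a0, out (w @ [False]), (marks n k, 0), a3, a4, a5, a6]"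
    by (intro runs_ActI) (simp add: act_simps act_tape_out_const)
  have "runs emit_tail [a0, out w, (marks n k, 0), a3, a4, a5, a6] (2 * n + 3 + 1)
    (if flag then ?S n else [a0, out (w @ [False]), (marks n k, 0), a3, a4, a5, a6])"
    unfolding emit_tail_def
  proof (rule runs_Cond)
    assume "map read_tape [a0, out w, (marks n k, 0), a3, a4, a5, a6] ! 6 = 2"
    then have flag by (simp add: flag)
    then show "runs (Act (\<lambda>s. (idle s)[1 := (2, R)]) ;;
        Loop (\<lambda>s. s ! 2 \<noteq> 0) (Act (\<lambda>s. (idle s)[1 := (s ! 2, R), 2 := (s ! 2, R)])))
      [a0, out w, (marks n k, 0), a3, a4, a5, a6] (2 * n + 3)
      (if flag then ?S n else [a0, out (w @ [False]), (marks n k, 0), a3, a4, a5, a6])"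
      using runs_mono[OF runs_Seq[OF 1 2], of "2 * n + 3"] by simp
  next
    assume "map read_tape [a0, out w, (marks n k, 0), a3, a4, a5, a6] ! 6 \<noteq> 2"
    then have "\<not> flag" by (simp add: flag)
    then show "runs (Act (\<lambda>s. (idle s)[1 := (1, R)]))
      [a0, out w, (marks n k, 0), a3, a4, a5, a6] (2 * n + 3)
      (if flag then ?S n else [a0, out (w @ [False]), (marks n k, 0), a3, a4, a5, a6])"
      using runs_mono[OF 3, of "2 * n + 3"] by simp
  qed
  then show ?thesis
    by (intro exI[of _ "if flag then ?S n else [a0, out (w @ [False]), (marks n k, 0), a3, a4, a5, a6]"])
      (auto simp: add.commute)
qed

lemma runs_emit:
  assumes flag: "read_tape a6 = 2 \<longleftrightarrow> flag"
  shows "\<exists>T. runs emit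
    [(tape_contents x, 0), out [], (marks n k, 0), (marks n k, 0), a4, (F, 0), a6] (100 * length x) T \<and>
    T ! 1 = out (take (Suc n) x @ new_rows flag k F n @ drop m x @
      (if flag then True # map (\<lambda>v. v < k) [0..<n] else [False]))"
proof -
  let ?S = "\<lambda>p w i. [(tape_contents x, int p), out w, (marks n k, int i), (marks n k, 0), a4, (F, - int i), a6]"
  let ?rows = "\<lambda>i. take (Suc n) x @ new_rows flag k F i"
  have lt: "n < length x" by (simp add: length_x m_eq)
  have 1: "runs (Loop (\<lambda>s. s ! 0 = 2) (Act (\<lambda>s. (idle s)[0 := (s ! 0, R), 1 := (s ! 0, R)])))
    (?S 0 [] 0) (n * (1 + 1) + 1) (?S n (take n x) 0)"
    using runs_copy[of 0 n "\<lambda>v. v = 2" "[]"] lt x_unary x_sep by (simp add: contents_x)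
  have 2: "runs (Act (\<lambda>s. (idle s)[0 := (s ! 0, R), 1 := (1, R)])) (?S n (take n x) 0) 1
    (?S (Suc n + 0 * n) (?rows 0) 0)"
    using lt x_sep
    by (intro runs_ActI) (simp add: act_simps act_tape_out_const take_Suc_conv_app_nth new_rows_def)
  have 3: "runs (Loop (\<lambda>s. s ! 2 \<noteq> 0) emit_row) (?S (Suc n + 0 * n) (?rows 0) 0)
    (n * (4 * n + 10 + 1) + 1) (?S (Suc n + n * n) (?rows n) n)"
  proof (rule runs_Loop[where S = "\<lambda>i. ?S (Suc n + i * n) (?rows i) i"])
    fix i assume i: "i < n"
    show "map read_tape (?S (Suc n + i * n) (?rows i) i) ! 2 \<noteq> 0"
      using i by (simp add: read_tape_pair marks_nth)
    have "?rows i @ map (new_bit flag k F i) [0..<n] = ?rows (Suc i)"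
      by (simp add: new_rows_def)
    then show "runs emit_row (?S (Suc n + i * n) (?rows i) i) (4 * n + 10)
        (?S (Suc n + Suc i * n) (?rows (Suc i)) (Suc i))"
      using runs_emit_row[OF i flag, of "?rows i" k a4 F] by (simp only:)
  next
    show "\<not> map read_tape (?S (Suc n + n * n) (?rows n) n) ! 2 \<noteq> 0"
      by (simp add: read_tape_pair marks_nth)
  qed
  let ?T = "\<lambda>p w. [(tape_contents x, int p), out w, (marks n k, 0), (marks n k, 0), a4, (F, - int n), a6]"
  have 4: "runs (rewind 2) (?S (Suc n + n * n) (?rows n) n) (2 * n + 5) (?T m (?rows n))"
    unfolding m_eq by (rule back_subst[of "runs _ _ _", OF runs_rewind_marks]) auto
  let ?l = "length x - m"
  have m: "m + ?l = length x" by (simp add: length_x)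
  have 5: "runs (Loop (\<lambda>s. s ! 0 \<noteq> 0) (Act (\<lambda>s. (idle s)[0 := (s ! 0, R), 1 := (s ! 0, R)])))
    (?T m (?rows n)) (?l * (1 + 1) + 1) (?T (m + ?l) (?rows n @ take ?l (drop m x)))"
    by (rule runs_copy[where P = "\<lambda>v. v \<noteq> 0"]) (use m in \<open>auto simp: contents_nth simp del: of_nat_add\<close>)
  obtain T where 6: "runs emit_tail (?T (m + ?l) (?rows n @ take ?l (drop m x))) (2 * n + 4) T"
    and T: "T ! 1 = out ((?rows n @ take ?l (drop m x)) @
      (if flag then True # map (\<lambda>v. v < k) [0..<n] else [False]))"
    using runs_emit_tail[OF flag] by blast
  have "runs emit (?S 0 [] 0) (100 * length x) T"
    unfolding emit_def
    by (rule runs_mono[OF runs_Seq[OF 1 runs_Seq[OF 2 runs_Seq[OF 3 runs_Seq[OF 4 runs_Seq[OF 5 6]]]]]])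
      (simp add: length_x m_eq algebra_simps)
  then show ?thesis
    using T by (intro exI[of _ T]) simp
qed

end

section \<open>The perturbed graph\<close>

text \<open>In the second case every residue class modulo \<open>k - 1\<close> becomes a clique. If
  \<open>n < k\<close>, the classes within \<open>{0..<n}\<close> have at most one element and the
  graph is left as it is.\<close>

definition perturb :: "nat \<Rightarrow> nat \<Rightarrow> nat graph \<Rightarrow> nat graph" where
  "perturb n k G = \<lparr>verts = {0..<n}, edges =
     (if few n k then {e \<in> edges G. \<not> e \<subseteq> {0..<k}}
      else edges G \<union> {{i, j} |i j. i < n \<and> j < n \<and> i \<noteq> j \<and> i mod (k - 1) = j mod (k - 1)})\<rparr>"

lemma not_few_square: "\<not> few n k \<Longrightarrow> 0 < k \<and> n \<le> (k - 1) * (k - 1)"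
proof -
  assume *: "\<not> few n k"
  have "n \<le> (k - 1) * (k - 1)" if "n < k"
  proof (cases "n = 0")
    case False
    then have "n * 1 \<le> (k - 1) * (k - 1)" using that by (intro mult_le_mono) auto
    then show ?thesis by simp
  qed simp
  with * show ?thesis by (auto simp: few_def not_less not_le)
qed

lemma simple_graph_perturb:
  assumes "simple_graph G" "verts G = {0..<n}"
  shows "simple_graph (perturb n k G)"
  using assms by (auto simp: simple_graph_def perturb_def)

lemma degree_le_card:
  assumes "finite U" "\<And>e. e \<in> edges H \<Longrightarrow> v \<in> e \<Longrightarrow> \<exists>u\<in>U. e = {v, u}"
  shows "degree H v \<le> card U"
proof -
  have "{e \<in> edges H. v \<in> e} \<subseteq> (\<lambda>u. {v, u}) ` U" using assms(2) by blast
  then show ?thesis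
    unfolding degree_def using surj_card_le[OF assms(1)] by blast
qed

text \<open>Within a residue class the quotient \<open>u div m\<close> determines \<open>u\<close>,
  and it takes at most \<open>(n - 1) div m + 1\<close> values. Leaving out \<open>v\<close> removes
  the extra 1; without this the bound by the square root would fail, for instance at
  \<open>n = m * m - 1\<close> for \<open>m \<ge> 2\<close> and \<open>v = 0\<close>.\<close>

lemma card_congruent_le:
  assumes "v < (n :: nat)" "0 < m"
  shows "card {u. u < n \<and> u \<noteq> v \<and> u mod m = v mod m} * m < n"
proof -
  let ?U = "{u. u < n \<and> u mod m = v mod m}"
  have "inj_on (\<lambda>u. u div m) ?U"
    by (rule inj_onI) (metis (mono_tags, lifting) div_mult_mod_eq mem_Collect_eq)
  moreover have "(\<lambda>u. u div m) ` ?U \<subseteq> {0..(n - 1) div m}"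
    by (auto intro!: div_le_mono)
  ultimately have "card ?U \<le> card {0..(n - 1) div m}"
    using card_inj_on_le by blast
  moreover have "{u. u < n \<and> u \<noteq> v \<and> u mod m = v mod m} = ?U - {v}" by auto
  ultimately have "card {u. u < n \<and> u \<noteq> v \<and> u mod m = v mod m} \<le> (n - 1) div m"
    using assms by (simp add: card_Diff_singleton)
  then have "card {u. u < n \<and> u \<noteq> v \<and> u mod m = v mod m} * m \<le> n - 1"
    using assms(2) less_eq_div_iff_mult_less_eq by blast
  then show ?thesis using assms(1) by linarith
qed

text \<open>In the case of added edges let \<open>q\<close> be the number of other vertices in the
  class of \<open>v\<close>. From \<open>q * (k - 1) < n \<le> (k - 1) * (k - 1)\<close> follows
  \<open>q < k - 1\<close>, and then \<open>q * q \<le> q * (k - 1) < n\<close>. Squaring the bound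
  keeps the argument within the natural numbers.\<close>

lemma degree_perturb:
  assumes G: "simple_graph G" "verts G = {0..<n}" and v: "v < n"
    and H: "edges H = sym_diff (edges G) (edges (perturb n k G))"
  shows "degree H v * degree H v \<le> n"
proof (cases "few n k")
  case True
  have "\<exists>u\<in>{0..<k} - {v}. e = {v, u}" if "e \<in> edges H" "v \<in> e" for e
  proof -
    have "card e = 2" "e \<subseteq> {0..<k}"
      using that True H G by (auto simp: perturb_def simple_graph_def)
    then show ?thesis using that(2) by (auto simp: card_2_iff)
  qed
  then have "degree H v \<le> card ({0..<k} - {v})" by (intro degree_le_card) auto
  moreover have "\<dots> \<le> k - 1" if "v < k" using that by (simp add: card_Diff_singleton)
  moreover have "degree H v = 0" if "\<not> v < k"
  proof -
    have "{e \<in> edges H. v \<in> e} = {}" using that True H by (auto simp: perturb_def)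
    then show ?thesis unfolding degree_def by (simp only: card.empty)
  qed
  ultimately have "degree H v \<le> k - 1" by (cases "v < k") auto
  then have "degree H v * degree H v \<le> (k - 1) * (k - 1)" by (intro mult_le_mono)
  then show ?thesis using True by (auto simp: few_def)
next
  case False
  let ?m = "k - 1"
  let ?q = "card {u. u < n \<and> u \<noteq> v \<and> u mod ?m = v mod ?m}"
  have "n \<le> ?m * ?m" using not_few_square[OF False] by simp
  then have "0 < ?m" using v by (cases "?m = 0") auto
  have "\<exists>u\<in>{u. u < n \<and> u \<noteq> v \<and> u mod ?m = v mod ?m}. e = {v, u}" if "e \<in> edges H" "v \<in> e" for e
    using that False H by (auto simp: perturb_def)
  then have le: "degree H v \<le> ?q" by (intro degree_le_card) auto
  have q: "?q * ?m < n" using card_congruent_le[OF v \<open>0 < ?m\<close>] .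
  then have "?q * ?m < ?m * ?m" using \<open>n \<le> ?m * ?m\<close> by linarith
  then have "?q < ?m" by simp
  then have "degree H v * degree H v \<le> ?q * ?m" using le by (intro mult_le_mono) auto
  then show ?thesis using q by linarith
qed

lemma dist_perturb:
  assumes "simple_graph G" "verts G = {0..<n}"
  shows "dist_Delta (G, k) (perturb n k G, k) \<le> ennreal (real n powr (1 / 2))"
proof -
  let ?H = "\<lparr>verts = verts G, edges = sym_diff (edges G) (edges (perturb n k G))\<rparr>"
  \<comment> \<open>The maximum is attained, either by some degree or by the inserted 0; the squared
    bound holds for both.\<close>
  have "max_degree ?H \<in> insert 0 (degree ?H ` verts ?H)"
    unfolding max_degree_def using assms by (intro Max_in) auto
  then have "max_degree ?H * max_degree ?H \<le> n"
    using degree_perturb[OF assms, of _ ?H k] assms(2) by auto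
  then have "real (max_degree ?H) * real (max_degree ?H) \<le> real n"
    by (metis of_nat_le_iff of_nat_mult)
  then have "real (max_degree ?H) \<le> real n powr (1 / 2)"
    by (simp add: powr_half_sqrt real_le_rsqrt power2_eq_square)
  then show ?thesis
    using assms(2)
    by (simp add: dist_Delta_def dist_Delta_graph_def perturb_def ennreal_of_nat_eq_real_of_nat
        ennreal_leI)
qed

lemma answers_perturb:
  assumes "simple_graph G" "verts G = {0..<n}"
  shows "(if few n k then Some {0..<k} else None) \<in> answers Independent_Set (perturb n k G, k)"
proof (cases "few n k")
  case True
  then have "independent_set (perturb n k G) {0..<k} \<and> card {0..<k} = k"
    by (auto simp: independent_set_def perturb_def few_def)
  with True show ?thesis
    by (auto simp: Independent_Set_def search_answers_def)
next
  case False
  let ?m = "k - 1"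
  have k: "0 < k" "n \<le> ?m * ?m" using not_few_square[OF False] by auto
  have "card S \<noteq> k" if S: "independent_set (perturb n k G) S" for S
  proof -
    have sub: "S \<subseteq> {0..<n}" using S by (simp add: independent_set_def perturb_def)
    then have "finite S" by (rule finite_subset) simp
    show ?thesis
    proof (cases "?m = 0")
      case True
      \<comment> \<open>Here \<open>k = 1\<close>, and \<open>n \<le> (k - 1) * (k - 1)\<close>
        forces \<open>n = 0\<close>, so \<open>S\<close> is empty.\<close>
      then show ?thesis using k sub by auto
    next
      case m: False
      have "inj_on (\<lambda>u. u mod ?m) S"
      proof (rule inj_onI, rule ccontr)
        fix u v assume uv: "u \<in> S" "v \<in> S" "u mod ?m = v mod ?m" "u \<noteq> v"
        moreover have "u < n" "v < n" using uv sub by auto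
        ultimately have "{u, v} \<in> edges (perturb n k G)"
          using False by (simp add: perturb_def) blast
        then show False using S uv by (simp add: independent_set_def)
      qed
      moreover have "(\<lambda>u. u mod ?m) ` S \<subseteq> {0..<?m}" using m by auto
      ultimately have "card S \<le> card {0..<?m}" using card_inj_on_le by blast
      then show ?thesis using k by simp
    qed
  qed
  with False show ?thesis
    by (auto simp: Independent_Set_def search_answers_def)
qed

section \<open>Running the program on encoded inputs\<close>

lemma encode_nat_bits:
  "\<exists>bs. encode_nat k = concat (map (\<lambda>b. [True, b]) bs) @ [False] \<and> val bs = k"
proof (induction k rule: less_induct)
  case (less k)
  show ?case
  proof (cases "k = 0")
    case True
    then show ?thesis by (intro exI[of _ "[]"]) (simp add: encode_nat.simps)
  next
    case False
    then obtain bs where "encode_nat (k div 2) = concat (map (\<lambda>b. [True, b]) bs) @ [False]"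
      "val bs = k div 2"
      using less[of "k div 2"] by auto
    then show ?thesis
      using False encode_nat.simps[of k] by (intro exI[of _ "odd k # bs"]) (cases "odd k"; auto)
  qed
qed

lemma length_concat_pairs: "length (concat (map (\<lambda>b. [True, b]) bs)) = 2 * length bs"
  by (induction bs) auto

lemma nth_concat_pairs:
  "i < length bs \<Longrightarrow> concat (map (\<lambda>b. [True, b]) bs) ! (2 * i) \<and>
     concat (map (\<lambda>b. [True, b]) bs) ! Suc (2 * i) = bs ! i"
proof (induction bs arbitrary: i)
  case (Cons b bs)
  then show ?case by (cases i) auto
qed simp

lemma length_concat_rows: "length (concat (map (\<lambda>i. map (f i) [0..<n]) [0..<m])) = m * n"
  by (induction m) auto

lemma nth_concat_rows:
  "i < m \<Longrightarrow> j < n \<Longrightarrow> concat (map (\<lambda>i. map (f i) [0..<n]) [0..<m]) ! (i * n + j) = f i j"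
proof (induction m)
  case (Suc m)
  show ?case
  proof (cases "i < m")
    case True
    have "Suc i * n \<le> m * n" using True by (intro mult_right_mono) auto
    then have "i * n + j < m * n" using Suc.prems by simp
    then show ?thesis
      using True Suc by (simp add: nth_append length_concat_rows)
  next
    case False
    then have "i = m" using Suc.prems by simp
    then show ?thesis
      using Suc.prems by (simp add: nth_append length_concat_rows)
  qed
qed simp

section \<open>The complete machine and its time bound\<close>

definition solver :: com where
  "solver = read_input ;; mark ;; choose_mode ;; emit"

lemma wf_solver: "wf_com 7 solver"
  by (simp add: solver_def wf_read_input wf_mark wf_choose_mode wf_emit)

text \<open>With \<open>l = length x\<close>, reading and writing cost \<open>100 * l\<close> each,
  marking at most \<open>4 * l * l + 20 * l\<close>, and choosing the mode at most
  \<open>100 * l * l\<close>, since \<open>n + 1 \<le> l\<close>; the remaining 3 steps unfold the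
  sequencing.\<close>

lemma (in input_string) runs_solver:
  "\<exists>T F. runs solver ((tape_contents x, 0) # replicate 6 (tape_contents [], 0))
     (104 * length x * length x + 220 * length x + 3) T \<and>
   fst (T ! 1) = tape_contents (take (Suc n) x @ new_rows (few n (val bs)) (val bs) F n @ drop m x @
     (if few n (val bs) then True # map (\<lambda>v. v < val bs) [0..<n] else [False])) \<and>
   (\<not> few n (val bs) \<longrightarrow>
     (\<forall>p. \<bar>p\<bar> < int n \<longrightarrow> (F p = 2 \<longleftrightarrow> p \<noteq> 0 \<and> int (val bs - 1) dvd p)))"
proof -
  let ?b = "(tape_contents [], 0) :: tape"
  let ?x = "(tape_contents x, 0) :: tape"
  let ?r = "(marks n (val bs), 0) :: tape"
  have init: "?x # replicate 6 ?b = [?x, ?b, ?b, ?b, ?b, ?b, ?b]"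
    by (simp add: numeral_eq_Suc)
  have lt: "n < length x" by (simp add: length_x m_eq)
  have 1: "runs read_input [?x, ?b, ?b, ?b, ?b, ?b, ?b] (100 * length x)
    [?x, ?b, (marks n 0, 0), (marks n 0, 0), (tape_contents bs, 0), ?b, ?b]"
    unfolding marks_0 by (rule runs_read_input)
  obtain a4 where 2: "runs mark [?x, ?b, (marks n 0, 0), (marks n 0, 0), (tape_contents bs, 0), ?b, ?b]
     ((n + 1) * (4 * length bs + 20)) [?x, ?b, ?r, ?r, a4, ?b, ?b]"
    and a4: "read_tape a4 = 2 \<longleftrightarrow> n < val bs"
    using runs_mark by blast
  obtain F a6 where 3: "runs choose_mode [?x, ?b, ?r, ?r, a4, ?b, ?b] (100 * (n + 1) * (n + 1))
      [?x, ?b, ?r, ?r, a4, (F, 0), a6]"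
    and flag: "read_tape a6 = 2 \<longleftrightarrow> few n (val bs)"
    and F: "\<not> few n (val bs) \<longrightarrow>
      (\<forall>p. \<bar>p\<bar> < int n \<longrightarrow> (F p = 2 \<longleftrightarrow> p \<noteq> 0 \<and> int (val bs - 1) dvd p))"
    using runs_choose_mode[of n x a4 "val bs" ?b] lt x_unary x_sep a4 by blast
  have nil: "?b = out []" by (simp add: out_def)
  obtain T where 4: "runs emit [?x, ?b, ?r, ?r, a4, (F, 0), a6] (100 * length x) T"
    and T: "T ! 1 = out (take (Suc n) x @ new_rows (few n (val bs)) (val bs) F n @ drop m x @
      (if few n (val bs) then True # map (\<lambda>v. v < val bs) [0..<n] else [False]))"
    unfolding nil using runs_emit[OF flag, of "val bs" a4 F] by blast
  have "(n + 1) * (4 * length bs + 20) \<le> length x * (4 * length x + 20)"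
    "(n + 1) * (n + 1) \<le> length x * length x"
    using lt by (auto intro!: mult_le_mono simp: length_x simp del: mult_Suc mult_Suc_right)
  then have "runs solver [?x, ?b, ?b, ?b, ?b, ?b, ?b] (104 * length x * length x + 220 * length x + 3) T"
    unfolding solver_def
    by (intro runs_mono[OF runs_Seq[OF 1 runs_Seq[OF 2 runs_Seq[OF 3 4]]]]) (simp add: algebra_simps)
  with T F show ?thesis
    unfolding init by (intro exI[of _ T] exI[of _ F]) (simp add: out_def)
qed

lemma runs_solver_encoded:
  fixes k :: nat
  assumes G: "simple_graph G" "verts G = {0..<n}"
  defines "x \<equiv> encode_input (G, k)"
  shows "\<exists>T. runs solver ((tape_contents x, 0) # replicate 6 (tape_contents [], 0))
     (104 * length x * length x + 220 * length x + 3) T \<and>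
   fst (T ! 1) = tape_contents
     (encode_answer ((perturb n k G, k), if few n k then Some {0..<k} else None))"
proof -
  obtain bs where bs: "encode_nat k = concat (map (\<lambda>b. [True, b]) bs) @ [False]" "val bs = k"
    using encode_nat_bits by blast
  define rows where
    "rows = concat (map (\<lambda>i. map (\<lambda>j. {i, j} \<in> edges G) [0..<n]) [0..<n])"
  define m where "m = Suc n + n * n"
  have len: "length rows = n * n" unfolding rows_def by (rule length_concat_rows)
  have x: "x = replicate n True @ [False] @ rows @ encode_nat k"
    using G(2) by (simp add: x_def encode_input_def encode_graph_def rows_def)
  have x_end: "x ! (m + p) = encode_nat k ! p" for p
    by (simp add: x m_def nth_append len)
  interpret input_string x n bs m
  proof
    show "x ! i" if "i < n" for i using that by (simp add: x nth_append)
    show "\<not> x ! n" by (simp add: x nth_append)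
    show "x ! (m + 2 * i)" if "i < length bs" for i
      unfolding x_end using that nth_concat_pairs[OF that] by (simp add: bs(1) nth_append length_concat_pairs)
    show "x ! Suc (m + 2 * i) = bs ! i" if "i < length bs" for i
      using x_end[of "Suc (2 * i)"] that nth_concat_pairs[OF that]
      by (simp add: bs(1) nth_append length_concat_pairs)
    show "\<not> x ! (m + 2 * length bs)"
      unfolding x_end by (simp add: bs(1) nth_append length_concat_pairs)
    show "length x = Suc (m + 2 * length bs)"
      by (simp add: x m_def len bs(1) length_concat_pairs)
  qed (simp add: m_def)
  obtain T F where run: "runs solver ((tape_contents x, 0) # replicate 6 (tape_contents [], 0))
      (104 * length x * length x + 220 * length x + 3) T"
    and T: "fst (T ! 1) = tape_contents (take (Suc n) x @ new_rows (few n k) k F n @ drop m x @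
      (if few n k then True # map (\<lambda>v. v < k) [0..<n] else [False]))"
    and F: "\<And>p. \<not> few n k \<Longrightarrow> \<bar>p\<bar> < int n \<Longrightarrow> F p = 2 \<longleftrightarrow> p \<noteq> 0 \<and> int (k - 1) dvd p"
    using runs_solver unfolding bs(2) by blast
  have loop: "{i} \<notin> edges G" for i using G(1) by (auto simp: simple_graph_def)
  have bit: "new_bit (few n k) k F i j \<longleftrightarrow> {i, j} \<in> edges (perturb n k G)" if ij: "i < n" "j < n" for i j
  proof -
    have "Suc i * n \<le> n * n" using ij by (intro mult_right_mono) auto
    then have less: "i * n + j < n * n" using ij by simp
    have "x ! (Suc n + i * n + j) = rows ! (i * n + j)"
      using less by (simp add: x nth_append len)
    also have "\<dots> = ({i, j} \<in> edges G)"
      unfolding rows_def by (rule nth_concat_rows) fact+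
    finally have xij: "x ! (Suc n + i * n + j) \<longleftrightarrow> {i, j} \<in> edges G" .
    \<comment> \<open>Tape 5 is addressed by signed differences, so divisibility is taken over the
      integers and has to be matched with \<open>mod\<close> on vertices.\<close>
    have "int (k - 1) dvd int j - int i \<longleftrightarrow> i mod (k - 1) = j mod (k - 1)"
      by (metis mod_eq_dvd_iff of_nat_eq_iff zmod_int)
    then have "F (int j - int i) = 2 \<longleftrightarrow> i \<noteq> j \<and> i mod (k - 1) = j mod (k - 1)" if "\<not> few n k"
      using F[OF that, of "int j - int i"] ij by auto
    then show ?thesis
      using ij unfolding new_bit_def xij by (auto simp: perturb_def doubleton_eq_iff)
  qed
  have "take (Suc n) x @ new_rows (few n k) k F n @ drop m x = encode_input (perturb n k G, k)"
  proof -
    have "new_rows (few n k) k F n =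
        concat (map (\<lambda>i. map (\<lambda>j. {i, j} \<in> edges (perturb n k G)) [0..<n]) [0..<n])"
      unfolding new_rows_def using bit by (intro arg_cong[of _ _ concat] map_cong) auto
    then show ?thesis
      by (simp add: x m_def len encode_input_def encode_graph_def perturb_def)
  qed
  then have "take (Suc n) x @ new_rows (few n k) k F n @ drop m x @
      (if few n k then True # map (\<lambda>v. v < k) [0..<n] else [False]) =
    encode_answer ((perturb n k G, k), if few n k then Some {0..<k} else None)"
    by (simp add: perturb_def flip: append_assoc)
  with run T show ?thesis by auto
qed

theorem theorem12:
  shows "encoded_problem encode_input encode_answer
           (Rel Independent_Set graph_size dist_Delta (\<lambda>n. ennreal (real n powr (1 / 2)))) \<in> FP"
proof (rule FP_I[OF wf_solver, where bound = "[:3, 220, 104:]"])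
  fix x
  assume "x \<in> inputs (encoded_problem encode_input encode_answer
    (Rel Independent_Set graph_size dist_Delta (\<lambda>n. ennreal (real n powr (1 / 2)))))"
  then obtain G k n where G: "simple_graph G" "verts G = {0..<n}" and x: "x = encode_input (G, k)"
    by (auto simp: encoded_problem_def Rel_def Independent_Set_def)
  let ?a = "((perturb n k G, k), if few n k then Some {0..<k} else None)"
  have "(perturb n k G, k) \<in> inputs Independent_Set"
    using simple_graph_perturb[OF G] by (auto simp: Independent_Set_def perturb_def)
  moreover have "(G, k) \<in> inputs Independent_Set"
    using G by (auto simp: Independent_Set_def)
  ultimately have "?a \<in> answers (Rel Independent_Set graph_size dist_Delta
      (\<lambda>n. ennreal (real n powr (1 / 2)))) (G, k)"
    using dist_perturb[OF G, of k] answers_perturb[OF G, of k] G(2)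
    by (simp add: Rel_def graph_size_def)
  then have "encode_answer ?a \<in> answers (encoded_problem encode_input encode_answer
      (Rel Independent_Set graph_size dist_Delta (\<lambda>n. ennreal (real n powr (1 / 2))))) x"
    using G x unfolding encoded_problem_def
    by (fastforce simp: Rel_def Independent_Set_def simp del: encode_answer.simps)
  moreover obtain T where "runs solver ((tape_contents x, 0) # replicate 6 (tape_contents [], 0))
      (104 * length x * length x + 220 * length x + 3) T"
    "fst (T ! 1) = tape_contents (encode_answer ?a)"
    using runs_solver_encoded[OF G, of k] x by blast
  moreover have "104 * length x * length x + 220 * length x + 3 = poly [:3, 220, 104:] (length x)"
    by (simp add: algebra_simps)
  ultimately show "\<exists>y\<in>answers (encoded_problem encode_input encode_answer
      (Rel Independent_Set graph_size dist_Delta (\<lambda>n. ennreal (real n powr (1 / 2))))) x.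
    \<exists>T. runs solver ((tape_contents x, 0) # replicate (7 - 1) (tape_contents [], 0))
      (poly [:3, 220, 104:] (length x)) T \<and> fst (T ! 1) = tape_contents y"
    by auto
qed simp

end
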